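(* Let $N\ge 1$ and let $\omega:\mathbb{R}^N\to[0,\infty)$ be either $\omega(x)=|x_1|^a$ with $a\in[0,1)$ if $N=1,2$ and $a\in[0,2/N)$ if $N\ge 3$ (where $x_1$ is the first coordinate of $x$), or $\omega(x)=|x|^b$ with $b\in[0,1)$. Let $h,l:[0,\infty)\to[0,\infty)$ be continuous, and let $f,g:[0,\infty)\to[0,\infty)$ be locally Lipschitz continuous with $f(0)=g(0)=0$. Consider the problem $$u_t-\mathrm{div}(\omega(x)\nabla u)=h(t)f(u)+l(t)g(u)\ \text{ in }\mathbb{R}^N\times(0,T),\qquad u(0)=u_0\ge 0,\tag{P}$$ with $u_0\in C_b(\mathbb{R}^N)$. (i) Suppose that $f$, $g$, $s\mapsto f(s)/s$ and $s\mapsto g(s)/s$ are nondecreasing in some interval $(0,m]$, and that there exists a nontrivial $0\le v_0\in C_b(\mathbb{R}^N)$ with $\|v_0\|_\infty\le m$ satisfying $$\int_0^\infty h(\sigma)\frac{f(\|S(\sigma)v_0\|_\infty)}{\|S(\sigma)v_0\|_\infty}\,d\sigma+\int_0^\infty l(\sigma)\frac{g(\|S(\sigma)v_0\|_\infty)}{\|S(\sigma)v_0\|_\infty}\,d\sigma<1.$$ Then there exists $\delta>0$ such that for $u_0=\delta v_0$ the solution of (P) is a global solution. (ii) Let $0\le u_0\in C_b(\mathbb{R}^N)$, $u_0\ne 0$, and suppose that one of the following conditions holds: (a) $f\in\Phi$ and there exists $\tau>0$ such that $\displaystyle\int_{\|S(\tau)u_0\|_\infty}^\infty\frac{d\sigma}{f(\sigma)}\le\int_0^\tau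 h(\sigma)\,d\sigma$; (b) $g\in\Phi$ and there exists $\tau>0$ such that $\displaystyle\int_{\|S(\tau)u_0\|_\infty}^\infty\frac{d\sigma}{g(\sigma)}\le\int_0^\tau l(\sigma)\,d\sigma$. Then the solution of (P) with initial condition $u_0$ is non-global.
   Context: $C_b(\mathbb{R}^N)$ is the set of bounded continuous functions on $\mathbb{R}^N$, and $\|\cdot\|_\infty$ is the sup norm. $\Gamma(x,y,t)$ denotes the fundamental solution of $v_t-\mathrm{div}(\omega(x)\nabla v)=0$, $x\in\mathbb{R}^N$, $t>0$, with pole at $(y,0)$, and $S(t)\phi(x):=\int_{\mathbb{R}^N}\Gamma(x,y,t)\phi(y)\,dy$. Put $\alpha=a$ if $\omega(x)=|x_1|^a$ and $\alpha=b$ if $\omega(x)=|x|^b$. The following known properties of $\Gamma$ are assumed: $\Gamma$ is continuous for $(x,t)\neq(y,0)$; $\int\Gamma(x,y,t)\,dx=\int\Gamma(x,y,t)\,dy=1$; $\Gamma(x,y,t)=\int\Gamma(x,\xi,t-s)\Gamma(\xi,y,s)\,d\xi$ for $t>s>0$; $0<\Gamma(x,y,t)\le c\,t^{-N/(2-\alpha)}$ with $c$ depending only on $N,\alpha$; and for $v_0\in C_b(\mathbb{R}^N)$, $S(t)v_0\in C((0,T),C_b(\mathbb{R}^N))$ solves the linear equation with $S(t)v_0(x)\to v_0(x)$ as $t\to0$. Solution: for $u_0\in C_b(\mathbb{R}^N)$, a (nonnegative) function $u\in C([0,T),C_b(\mathbb{R}^N))$ is a solution of (P) if $$u(t)=S(t)u_0+\int_0^tS(t-\sigma)h(\sigma)f(u(\sigma))\,d\sigma+\int_0^tS(t-\sigma)l(\sigma)g(u(\sigma))\,d\sigma,\quad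 t\in(0,T).$$ It is a global solution if $T=\infty$; "non-global" means that there is no global solution with the given initial condition. $\Phi$ is the set of functions $\gamma:[0,\infty)\to[0,\infty)$ such that: $\int_z^\infty\frac{d\sigma}{\gamma(\sigma)}<\infty$ for all $z>0$; $\gamma(S(t)v_0)\le S(t)\gamma(v_0)$ for all $0\le v_0\in C_b(\mathbb{R}^N)$ and $t>0$; and $\gamma$ is nondecreasing with $\gamma(s)>0$ for all $s>0$.
   Formalization: Solutions are taken in C((0,T),C_b) with u(0)=u_0 and ‖u(t)−S(t)u_0‖_∞→0 as t→0, instead of u∈C([0,T),C_b); with sup-norm continuity at t=0, (i) fails for v_0 that is not uniformly continuous (e.g. ω=1). *)

theory Defs
  imports "HOL-Analysis.Analysis"
begin

section \<open>The weight\<close>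

text \<open>\<open>s\<^sup>a\<close> for \<open>s \<ge> 0\<close>, with \<open>s\<^sup>0 = 1\<close> also at \<open>s = 0\<close> (whereas \<open>0 powr 0 = 0\<close>).\<close>

definition rpow :: "real \<Rightarrow> real \<Rightarrow> real" where
  "rpow s a = (if a = 0 then 1 else s powr a)"

text \<open>\<open>N\<close> is \<^term>\<open>CARD('n)\<close>. An abstract finite index type has no distinguished first element, so
  the index \<open>i\<close> of the coordinate called \<open>x\<^sub>1\<close> is a parameter.\<close>

definition degenerate_weight :: "'n::finite \<Rightarrow> real \<Rightarrow> (real ^ 'n \<Rightarrow> real) \<Rightarrow> bool" where
  "degenerate_weight i \<alpha> \<omega> \<longleftrightarrow>
     (0 \<le> \<alpha> \<and> (if CARD('n) \<le> 2 then \<alpha> < 1 else \<alpha> < 2 / real CARD('n))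
        \<and> \<omega> = (\<lambda>x. rpow \<bar>x $ i\<bar> \<alpha>)) \<or>
     (0 \<le> \<alpha> \<and> \<alpha> < 1 \<and> \<omega> = (\<lambda>x. rpow (norm x) \<alpha>))"


section \<open>The linear equation and its fundamental solution\<close>

text \<open>A \<open>C\<^sup>1\<close> test function on space-time, compactly supported in \<open>(0,\<infinity>) \<times> \<real>\<^sup>N\<close>, with its gradient
  \<open>D = (\<partial>\<^sub>t \<phi>, \<nabla>\<^sub>x \<phi>)\<close>.\<close>

definition test_function ::
    "(real \<times> (real ^ 'n::finite) \<Rightarrow> real) \<Rightarrow> (real \<times> (real ^ 'n) \<Rightarrow> real \<times> (real ^ 'n)) \<Rightarrow> bool" where
  "test_function \<phi> D \<longleftrightarrow>
     (\<forall>z. GDERIV \<phi> z :> D z) \<and> continuous_on UNIV D \<and>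
     (\<exists>K. compact K \<and> K \<subseteq> {0<..} \<times> UNIV \<and> (\<forall>z. z \<notin> K \<longrightarrow> \<phi> z = 0))"

text \<open>Weak solutions of \<open>v\<^sub>t - div (\<omega> \<nabla>v) = 0\<close> in \<open>\<real>\<^sup>N \<times> (0,\<infinity>)\<close>; time is the first component of
  the argument. The field \<open>G\<close> is the spatial gradient of \<open>v\<close> in the sense of distributions, and \<open>v\<close>
  lies in the local energy space: \<open>v\<^sup>2\<close> and \<open>\<omega> |\<nabla>v|\<^sup>2\<close> are locally integrable. Since \<open>1 / \<omega>\<close> is
  locally integrable for the weights above, \<open>G\<close> is then itself locally integrable.\<close>

definition weak_solution ::
    "(real ^ 'n::finite \<Rightarrow> real) \<Rightarrow> (real \<times> (real ^ 'n) \<Rightarrow> real) \<Rightarrow> bool" where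
  "weak_solution \<omega> v \<longleftrightarrow>
     set_borel_measurable borel ({0<..} \<times> UNIV) v \<and>
     (\<exists>G :: real \<times> (real ^ 'n) \<Rightarrow> real ^ 'n.
        set_borel_measurable borel ({0<..} \<times> UNIV) G \<and>
        (\<forall>K. compact K \<and> K \<subseteq> {0<..} \<times> UNIV \<longrightarrow>
           set_integrable lborel K (\<lambda>z. (v z)\<^sup>2) \<and>
           set_integrable lborel K (\<lambda>z. \<omega> (snd z) * (norm (G z))\<^sup>2)) \<and>
        (\<forall>\<phi> D. test_function \<phi> D \<longrightarrow>
           (LINT z|lborel. v z *\<^sub>R snd (D z)) = - (LINT z|lborel. \<phi> z *\<^sub>R G z) \<and>
           (LINT z|lborel. v z * fst (D z) - \<omega> (snd z) * (G z \<bullet> snd (D z))) = 0))"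

text \<open>The argument order is \<open>\<Gamma> x y t\<close>, with pole at \<open>(y,0)\<close>.\<close>

definition fundamental_solution ::
    "(real ^ 'n::finite \<Rightarrow> real) \<Rightarrow> (real ^ 'n \<Rightarrow> real ^ 'n \<Rightarrow> real \<Rightarrow> real) \<Rightarrow> bool" where
  "fundamental_solution \<omega> \<Gamma> \<longleftrightarrow>
     (\<forall>y. weak_solution \<omega> (\<lambda>(t, x). \<Gamma> x y t) \<and>
          (\<forall>\<phi>. continuous_on UNIV \<phi> \<and> (\<exists>K. compact K \<and> (\<forall>x. x \<notin> K \<longrightarrow> \<phi> x = 0)) \<longrightarrow>
             ((\<lambda>t. LINT x|lborel. \<Gamma> x y t * \<phi> x) \<longlongrightarrow> \<phi> y) (at_right 0)))"

definition kernel_op ::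
    "(real ^ 'n::finite \<Rightarrow> real ^ 'n \<Rightarrow> real \<Rightarrow> real) \<Rightarrow> real \<Rightarrow> (real ^ 'n \<Rightarrow> real) \<Rightarrow> real ^ 'n \<Rightarrow> real"
  where "kernel_op \<Gamma> t \<phi> x = (LINT y|lborel. \<Gamma> x y t * \<phi> y)"

text \<open>\<open>S(t)\<phi>\<close> as an element of \<open>C\<^sub>b(\<real>\<^sup>N)\<close>, so that \<^const>\<open>norm\<close> is the sup norm. It is meaningful
  when \<^term>\<open>kernel_op \<Gamma> t \<phi>\<close> is bounded and continuous, which \<open>kernel_properties\<close> below contains
  for \<open>t > 0\<close>.\<close>

definition semigroup_S ::
    "(real ^ 'n::finite \<Rightarrow> real ^ 'n \<Rightarrow> real \<Rightarrow> real) \<Rightarrow> real \<Rightarrow> ((real ^ 'n) \<Rightarrow>\<^sub>C real) \<Rightarrow> ((real ^ 'n) \<Rightarrow>\<^sub>C real)"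
  where "semigroup_S \<Gamma> t \<phi> = Bcontfun (kernel_op \<Gamma> t (apply_bcontfun \<phi>))"

text \<open>A Bochner integral with nonzero value entails integrability, so the normalisation and the
  Chapman-Kolmogorov identity include the integrability of their integrands.\<close>

definition kernel_properties ::
    "(real ^ 'n::finite \<Rightarrow> real) \<Rightarrow> real \<Rightarrow> (real ^ 'n \<Rightarrow> real ^ 'n \<Rightarrow> real \<Rightarrow> real) \<Rightarrow> bool" where
  "kernel_properties \<omega> \<alpha> \<Gamma> \<longleftrightarrow>
     continuous_on {(x, y, t). 0 \<le> t \<and> (x, t) \<noteq> (y, 0)} (\<lambda>(x, y, t). \<Gamma> x y t) \<and>
     (\<forall>y t. 0 < t \<longrightarrow> (LINT x|lborel. \<Gamma> x y t) = 1) \<and>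
     (\<forall>x t. 0 < t \<longrightarrow> (LINT y|lborel. \<Gamma> x y t) = 1) \<and>
     (\<forall>x y s t. 0 < s \<and> s < t \<longrightarrow> \<Gamma> x y t = (LINT \<xi>|lborel. \<Gamma> x \<xi> (t - s) * \<Gamma> \<xi> y s)) \<and>
     (\<exists>c. \<forall>x y t. 0 < t \<longrightarrow> 0 < \<Gamma> x y t \<and> \<Gamma> x y t \<le> c * t powr (- real CARD('n) / (2 - \<alpha>))) \<and>
     (\<forall>v0 :: (real ^ 'n) \<Rightarrow>\<^sub>C real.
        (\<forall>t>0. kernel_op \<Gamma> t (apply_bcontfun v0) \<in> bcontfun) \<and>
        continuous_on {0<..} (\<lambda>t. semigroup_S \<Gamma> t v0) \<and>
        weak_solution \<omega> (\<lambda>(t, x). kernel_op \<Gamma> t (apply_bcontfun v0) x) \<and>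
        (\<forall>x. ((\<lambda>t. kernel_op \<Gamma> t (apply_bcontfun v0) x) \<longlongrightarrow> v0 x) (at_right 0)))"


section \<open>Solutions of the semilinear problem\<close>

text \<open>\<open>\<integral>\<^sub>0\<^sup>t S(t - \<sigma>) h(\<sigma>) f(u(\<sigma>)) d\<sigma>\<close> at the point \<open>x\<close>; the interval is open because \<open>\<Gamma>\<close> is a kernel
  for positive times only.\<close>

definition duhamel ::
    "(real ^ 'n::finite \<Rightarrow> real ^ 'n \<Rightarrow> real \<Rightarrow> real) \<Rightarrow> (real \<Rightarrow> real) \<Rightarrow> (real \<Rightarrow> real) \<Rightarrow>
     (real \<Rightarrow> ((real ^ 'n) \<Rightarrow>\<^sub>C real)) \<Rightarrow> real \<Rightarrow> real ^ 'n \<Rightarrow> real" where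
  "duhamel \<Gamma> h f u t x =
     (LINT \<sigma>:{0<..<t}|lborel. kernel_op \<Gamma> (t - \<sigma>) (\<lambda>y. h \<sigma> * f (u \<sigma> y)) x)"

definition integral_equation ::
    "(real ^ 'n::finite \<Rightarrow> real ^ 'n \<Rightarrow> real \<Rightarrow> real) \<Rightarrow> (real \<Rightarrow> real) \<Rightarrow> (real \<Rightarrow> real) \<Rightarrow>
     (real \<Rightarrow> real) \<Rightarrow> (real \<Rightarrow> real) \<Rightarrow> ((real ^ 'n) \<Rightarrow>\<^sub>C real) \<Rightarrow> ereal \<Rightarrow>
     (real \<Rightarrow> ((real ^ 'n) \<Rightarrow>\<^sub>C real)) \<Rightarrow> bool" where
  "integral_equation \<Gamma> h l f g u0 T u \<longleftrightarrow>
     (\<forall>t>0. ereal t < T \<longrightarrow>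
        (\<forall>x. u t x = semigroup_S \<Gamma> t u0 x + duhamel \<Gamma> h f u t x + duhamel \<Gamma> l g u t x))"

text \<open>Continuity at \<open>t = 0\<close> is required in the form \<open>\<parallel>u(t) - S(t)u\<^sub>0\<parallel>\<^sub>\<infinity> \<rightarrow> 0\<close>, the usual convention for
  \<open>L\<^sup>\<infinity>\<close> data. Sup norm continuity of \<open>u\<close> itself at \<open>t = 0\<close> would force \<open>S(t)u\<^sub>0 \<rightarrow> u\<^sub>0\<close> uniformly, and
  then (already for \<open>\<omega> = 1\<close>, when \<open>S(t)u\<^sub>0\<close> is uniformly continuous) no bounded continuous \<open>u\<^sub>0\<close> that
  is not uniformly continuous would have any solution. The lemma \<open>is_solution_C0\<close> below shows that a
  function is in \<open>C([0,T), C\<^sub>b)\<close> and satisfies the integral equation iff it is a solution in the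
  present sense and \<open>S(t)u\<^sub>0 \<rightarrow> u\<^sub>0\<close> uniformly.\<close>

definition is_solution ::
    "(real ^ 'n::finite \<Rightarrow> real ^ 'n \<Rightarrow> real \<Rightarrow> real) \<Rightarrow> (real \<Rightarrow> real) \<Rightarrow> (real \<Rightarrow> real) \<Rightarrow>
     (real \<Rightarrow> real) \<Rightarrow> (real \<Rightarrow> real) \<Rightarrow> ((real ^ 'n) \<Rightarrow>\<^sub>C real) \<Rightarrow> ereal \<Rightarrow>
     (real \<Rightarrow> ((real ^ 'n) \<Rightarrow>\<^sub>C real)) \<Rightarrow> bool" where
  "is_solution \<Gamma> h l f g u0 T u \<longleftrightarrow>
     0 < T \<and> u 0 = u0 \<and> (\<forall>t\<ge>0. ereal t < T \<longrightarrow> (\<forall>x. 0 \<le> apply_bcontfun (u t) x)) \<and>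
     continuous_on {t. 0 < t \<and> ereal t < T} u \<and>
     ((\<lambda>t. norm (u t - semigroup_S \<Gamma> t u0)) \<longlongrightarrow> 0) (at_right 0) \<and>
     integral_equation \<Gamma> h l f g u0 T u"

definition is_global_solution ::
    "(real ^ 'n::finite \<Rightarrow> real ^ 'n \<Rightarrow> real \<Rightarrow> real) \<Rightarrow> (real \<Rightarrow> real) \<Rightarrow> (real \<Rightarrow> real) \<Rightarrow>
     (real \<Rightarrow> real) \<Rightarrow> (real \<Rightarrow> real) \<Rightarrow> ((real ^ 'n) \<Rightarrow>\<^sub>C real) \<Rightarrow>
     (real \<Rightarrow> ((real ^ 'n) \<Rightarrow>\<^sub>C real)) \<Rightarrow> bool" where
  "is_global_solution \<Gamma> h l f g u0 u \<longleftrightarrow> is_solution \<Gamma> h l f g u0 \<infinity> u"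


section \<open>The class \<open>\<Phi>\<close>\<close>

text \<open>Functions on \<open>[0,\<infinity>)\<close> are total functions whose values at negative arguments are irrelevant.\<close>

definition Phi_class ::
    "(real ^ 'n::finite \<Rightarrow> real ^ 'n \<Rightarrow> real \<Rightarrow> real) \<Rightarrow> (real \<Rightarrow> real) set" where
  "Phi_class \<Gamma> =
     {\<gamma>. (\<forall>s\<ge>0. 0 \<le> \<gamma> s) \<and>
         (\<forall>z>0. (\<integral>\<^sup>+\<sigma>\<in>{z..}. ennreal (1 / \<gamma> \<sigma>) \<partial>lborel) < \<infinity>) \<and>
         (\<forall>v0 :: (real ^ 'n) \<Rightarrow>\<^sub>C real. (\<forall>x. 0 \<le> apply_bcontfun v0 x) \<longrightarrow>
            (\<forall>t>0. \<forall>x. \<gamma> (semigroup_S \<Gamma> t v0 x) \<le> kernel_op \<Gamma> t (\<lambda>y. \<gamma> (v0 y)) x)) \<and>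
         mono_on {0..} \<gamma> \<and> (\<forall>s>0. 0 < \<gamma> s)}"


section \<open>Comparison with continuity up to \<open>t = 0\<close>\<close>

lemma abs_kernel_op_le:
  assumes K: "kernel_properties \<omega> \<alpha> \<Gamma>" and t: "0 < t" and b: "\<And>y. \<bar>\<phi> y\<bar> \<le> C"
  shows "\<bar>kernel_op \<Gamma> t \<phi> x\<bar> \<le> C"
proof (cases "integrable lborel (\<lambda>y. \<Gamma> x y t * \<phi> y)")
  case True
  have 1: "(LINT y|lborel. \<Gamma> x y t) = 1" and pos: "\<And>y. 0 < \<Gamma> x y t"
    using K t by (auto simp: kernel_properties_def)
  then have int: "integrable lborel (\<lambda>y. \<Gamma> x y t)"
    using not_integrable_integral_eq by fastforce
  have "norm (LINT y|lborel. \<Gamma> x y t * \<phi> y) \<le> (LINT y|lborel. \<Gamma> x y t * C)"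
  proof (intro Bochner_Integration.integral_norm_bound_integral True)
    show "norm (\<Gamma> x y t * \<phi> y) \<le> \<Gamma> x y t * C" for y
      using b[of y] pos[of y] by (simp add: abs_mult)
  qed (use int in auto)
  then show ?thesis by (simp add: kernel_op_def 1)
next
  case False
  then show ?thesis using b[of 0] by (simp add: kernel_op_def not_integrable_integral_eq)
qed

lemma abs_duhamel_le:
  assumes K: "kernel_properties \<omega> \<alpha> \<Gamma>" and t: "0 < t"
    and b: "\<And>\<sigma> y. 0 < \<sigma> \<Longrightarrow> \<sigma> < t \<Longrightarrow> \<bar>h \<sigma> * f (apply_bcontfun (u \<sigma>) y)\<bar> \<le> C"
  shows "\<bar>duhamel \<Gamma> h f u t x\<bar> \<le> t * C"
proof -
  have C: "0 \<le> C" using b[of "t/2" 0] t by linarith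
  let ?F = "\<lambda>\<sigma>. indicator {0<..<t} \<sigma> *\<^sub>R kernel_op \<Gamma> (t - \<sigma>) (\<lambda>y. h \<sigma> * f (apply_bcontfun (u \<sigma>) y)) x"
  show ?thesis
  proof (cases "integrable lborel ?F")
    case True
    have "norm (LINT \<sigma>|lborel. ?F \<sigma>) \<le> (LINT \<sigma>|lborel. indicator {0<..<t} \<sigma> * C)"
    proof (intro Bochner_Integration.integral_norm_bound_integral True)
      show "norm (?F \<sigma>) \<le> indicator {0<..<t} \<sigma> * C" for \<sigma>
        using abs_kernel_op_le[OF K, of "t - \<sigma>" "\<lambda>y. h \<sigma> * f (apply_bcontfun (u \<sigma>) y)" C x] b C
        by (auto simp: indicator_def)
    qed (use t in auto)
    then show ?thesis using t by (simp add: duhamel_def set_lebesgue_integral_def)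
  next
    case False
    then show ?thesis using t C
      by (simp add: duhamel_def set_lebesgue_integral_def not_integrable_integral_eq)
  qed
qed

lemma source_bounded:
  fixes u :: "real \<Rightarrow> ((real ^ 'n::finite) \<Rightarrow>\<^sub>C real)" and h f :: "real \<Rightarrow> real"
  assumes u: "continuous_on {0..r} u" and u0: "\<And>t x. 0 \<le> t \<Longrightarrow> t \<le> r \<Longrightarrow> 0 \<le> apply_bcontfun (u t) x"
    and h: "continuous_on {0..} h" and f: "continuous_on {0..} f"
  obtains C where "\<And>\<sigma> y. 0 < \<sigma> \<Longrightarrow> \<sigma> \<le> r \<Longrightarrow> \<bar>h \<sigma> * f (apply_bcontfun (u \<sigma>) y)\<bar> \<le> C"
proof -
  obtain M where M: "\<And>t. t \<in> {0..r} \<Longrightarrow> norm (u t) \<le> M"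
    using compact_imp_bounded[OF compact_continuous_image[OF u]]
    by (fastforce simp: bounded_iff)
  have bd: "\<exists>A. \<forall>s\<in>{0..R}. \<bar>k s\<bar> \<le> A" if "continuous_on {0..} k" for k :: "real \<Rightarrow> real" and R
  proof -
    have "continuous_on {0..R} k" using that by (rule continuous_on_subset) auto
    then have "bounded (k ` {0..R})" by (intro compact_imp_bounded compact_continuous_image) auto
    then show ?thesis by (auto simp: bounded_iff)
  qed
  obtain A B where A: "\<forall>t\<in>{0..r}. \<bar>h t\<bar> \<le> A" and B: "\<forall>s\<in>{0..M}. \<bar>f s\<bar> \<le> B"
    using bd[OF h] bd[OF f] by meson
  have "\<bar>h \<sigma> * f (apply_bcontfun (u \<sigma>) y)\<bar> \<le> A * B" if "0 < \<sigma>" "\<sigma> \<le> r" for \<sigma> y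
  proof -
    have "apply_bcontfun (u \<sigma>) y \<le> M" using norm_bounded[of "u \<sigma>" y] M[of \<sigma>] that by auto
    then have "\<bar>f (apply_bcontfun (u \<sigma>) y)\<bar> \<le> B" using B u0 that by auto
    moreover have "\<bar>h \<sigma>\<bar> \<le> A" using A that by auto
    ultimately show ?thesis unfolding abs_mult by (intro mult_mono) auto
  qed
  then show thesis by (rule that)
qed

lemma is_solution_C0:
  assumes K: "kernel_properties \<omega> \<alpha> \<Gamma>"
    and h: "continuous_on {0..} h" and l: "continuous_on {0..} l"
    and f: "continuous_on {0..} f" and g: "continuous_on {0..} g"
  shows "0 < T \<and> u 0 = u0 \<and> (\<forall>t\<ge>0. ereal t < T \<longrightarrow> (\<forall>x. 0 \<le> apply_bcontfun (u t) x)) \<and>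
           continuous_on {t. 0 \<le> t \<and> ereal t < T} u \<and> integral_equation \<Gamma> h l f g u0 T u
         \<longleftrightarrow> is_solution \<Gamma> h l f g u0 T u \<and> ((\<lambda>t. semigroup_S \<Gamma> t u0) \<longlongrightarrow> u0) (at_right 0)"
    (is "?L \<longleftrightarrow> ?R")
proof
  assume L: ?L
  then obtain r where r: "0 < r" "ereal r < T"
    using ereal_dense2[of 0 T] by (auto simp: zero_ereal_def)
  have le_T: "ereal t < T" if "t \<le> r" for t using r that le_less_trans ereal_less_eq(3) by blast
  have cr: "continuous_on {0..r} u"
    using L le_T by (auto intro: continuous_on_subset)
  have nn: "0 \<le> apply_bcontfun (u t) x" if "0 \<le> t" "t \<le> r" for t x using L le_T that by blast
  obtain C1 where C1: "\<And>\<sigma> y. 0 < \<sigma> \<Longrightarrow> \<sigma> \<le> r \<Longrightarrow> \<bar>h \<sigma> * f (apply_bcontfun (u \<sigma>) y)\<bar> \<le> C1"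
    using source_bounded[OF cr nn h f] by metis
  obtain C2 where C2: "\<And>\<sigma> y. 0 < \<sigma> \<Longrightarrow> \<sigma> \<le> r \<Longrightarrow> \<bar>l \<sigma> * g (apply_bcontfun (u \<sigma>) y)\<bar> \<le> C2"
    using source_bounded[OF cr nn l g] by metis
  have bd: "norm (u t - semigroup_S \<Gamma> t u0) \<le> t * C1 + t * C2" if t: "0 < t" "t < r" for t
  proof (rule norm_bound)
    fix x
    have "u t x = semigroup_S \<Gamma> t u0 x + duhamel \<Gamma> h f u t x + duhamel \<Gamma> l g u t x"
      using L t le_T[of t] by (auto simp: integral_equation_def)
    moreover have "\<bar>duhamel \<Gamma> h f u t x\<bar> \<le> t * C1"
      by (rule abs_duhamel_le[OF K t(1)]) (use C1 t in auto)
    moreover have "\<bar>duhamel \<Gamma> l g u t x\<bar> \<le> t * C2"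
      by (rule abs_duhamel_le[OF K t(1)]) (use C2 t in auto)
    ultimately show "norm ((u t - semigroup_S \<Gamma> t u0) x) \<le> t * C1 + t * C2" by simp
  qed
  have lim: "((\<lambda>t. norm (u t - semigroup_S \<Gamma> t u0)) \<longlongrightarrow> 0) (at_right 0)"
  proof (rule tendsto_sandwich[OF _ _ tendsto_const])
    show "\<forall>\<^sub>F t in at_right 0. norm (u t - semigroup_S \<Gamma> t u0) \<le> t * C1 + t * C2"
      using bd r(1) by (auto simp: eventually_at_right_field)
    show "((\<lambda>t. t * C1 + t * C2) \<longlongrightarrow> 0) (at_right 0)" by (auto intro!: tendsto_eq_intros)
  qed auto
  have "(u \<longlongrightarrow> u 0) (at 0 within {0..r})" using cr r(1) by (auto simp: continuous_on_def)
  then have "(u \<longlongrightarrow> u0) (at_right 0)" using L r(1) by (simp add: at_within_Icc_at_right)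
  from tendsto_diff[OF this lim[THEN tendsto_norm_zero_cancel]]
  have "((\<lambda>t. semigroup_S \<Gamma> t u0) \<longlongrightarrow> u0) (at_right 0)" by simp
  moreover have "continuous_on {t. 0 < t \<and> ereal t < T} u"
    using L by (auto intro: continuous_on_subset)
  ultimately show ?R using L lim by (simp add: is_solution_def)
next
  assume R: ?R
  then have lim: "((\<lambda>t. norm (u t - semigroup_S \<Gamma> t u0)) \<longlongrightarrow> 0) (at_right 0)"
    and c: "continuous_on {t. 0 < t \<and> ereal t < T} u" and u0: "u 0 = u0"
    by (auto simp: is_solution_def)
  from tendsto_add[OF lim[THEN tendsto_norm_zero_cancel] conjunct2[OF R]] u0
  have 0: "(u \<longlongrightarrow> u 0) (at_right 0)" by simp
  have op: "open {t. 0 < t \<and> ereal t < T}"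
    by (intro open_Collect_conj open_Collect_less continuous_intros)
  have "continuous_on {t. 0 \<le> t \<and> ereal t < T} u"
    unfolding continuous_on_def
  proof
    fix t assume t: "t \<in> {t. 0 \<le> t \<and> ereal t < T}"
    show "(u \<longlongrightarrow> u t) (at t within {t. 0 \<le> t \<and> ereal t < T})"
    proof (cases "t = 0")
      case True
      have "at 0 within {t. 0 \<le> t \<and> ereal t < T} \<le> at_right 0"
        unfolding at_within_def by (intro inf_mono) auto
      then show ?thesis using 0 True tendsto_mono by blast
    next
      case False
      then have "isCont u t" using c op t by (simp add: continuous_on_eq_continuous_at)
      then show ?thesis by (auto simp: isCont_def intro: tendsto_within_subset)
    qed
  qed
  then show ?L using R by (auto simp: is_solution_def)
qed

end

theory Submission
  imports Defs
begin

text \<open>Throughout, \<open>S(t)\<close> is a positivity preserving, mass preserving semigroup of integral operators.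

Global existence. Let \<open>0 \<le> u(\<sigma>) \<le> S(\<sigma>)v\<^sub>0\<close> for all \<open>\<sigma>\<close> and \<open>n(\<sigma>) = \<parallel>S(\<sigma>)v\<^sub>0\<parallel>\<close>. Since \<open>f(s)/s\<close> is nondecreasing
on \<open>(0,m]\<close>, \<open>f(u(\<sigma>)) \<le> f(n(\<sigma>))/n(\<sigma>) \<cdot> S(\<sigma>)v\<^sub>0\<close>, and by positivity and the semigroup law
\<open>\<integral>\<^sub>0\<^sup>t S(t-\<sigma>) h(\<sigma>) f(u(\<sigma>)) d\<sigma> \<le> S(t)v\<^sub>0 \<cdot> \<integral>\<^sub>0\<^sup>t h(\<sigma>) f(n(\<sigma>))/n(\<sigma>) d\<sigma>\<close>. The same holds for \<open>l\<close> and \<open>g\<close>. So if the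
two integrals sum to \<open>I < 1\<close> and \<open>\<delta> = 1 - I\<close>, the right-hand side of the integral equation with
datum \<open>\<delta> v\<^sub>0\<close> maps the order interval \<open>0 \<le> u(t) \<le> S(t)v\<^sub>0\<close> into itself. There \<open>u\<close> has values in \<open>[0,m]\<close>,
where the nonlinearities are Lipschitz, and on each bounded time interval the map contracts a sup
norm weighted by \<open>exp(-2Lt)\<close>. The Picard iterates therefore converge locally uniformly in time to a
global solution (\<open>global_solution_below_linear_flow\<close>).

Blow-up, under the hypothesis on \<open>f\<close> (that on \<open>g\<close> is symmetric). Let \<open>u\<close> be a global solution, \<open>M\<close> a
bound for \<open>u\<close> on \<open>(0,\<tau>]\<close>, \<open>z = (S(\<tau>)u\<^sub>0)(x)\<close> and \<open>\<psi>(t) = (S(\<tau>-t)u(t))(x)\<close>. Dropping the nonnegative term with \<open>g\<close>, applying \<open>S(\<tau>-t)\<close> to the integral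
equation and using the Jensen inequality in the definition of \<open>\<Phi>\<close> gives
\<open>\<psi>(t) \<ge> z + \<integral>\<^sub>0\<^sup>t h(\<sigma>) f(\<psi>(\<sigma>)) d\<sigma>\<close>. Separation of variables (\<open>osgood_comparison\<close>) yields
\<open>\<integral>\<^sub>0\<^sup>\<tau> h \<le> \<integral>\<^sub>z\<^sup>M ds/f(s)\<close>. As \<open>x\<close> varies, \<open>z\<close> comes arbitrarily close to \<open>\<parallel>S(\<tau>)u\<^sub>0\<parallel>\<close>, so this bound also holds
with \<open>\<parallel>S(\<tau>)u\<^sub>0\<parallel>\<close> in place of \<open>z\<close>; and as \<open>M\<close> is finite it falls short of the integral up to \<open>\<infinity>\<close> by a
positive amount. This contradicts the hypothesis.

What remains is that the Duhamel integral \<open>D(t) = \<integral>\<^sub>0\<^sup>t S(t-\<sigma>)\<phi>(\<sigma>) d\<sigma>\<close> is a continuous curve in \<open>C\<^sub>b\<close>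
although \<open>S(t)\<close> need not tend to the identity uniformly as \<open>t \<rightarrow> 0\<close>. It is treated pointwise in \<open>x\<close>.
Fubini and the Chapman-Kolmogorov identity give \<open>D(t) = S(t-s)D(s) + \<integral>\<^sub>s\<^sup>t S(t-\<sigma>)\<phi>(\<sigma>) d\<sigma>\<close>
(\<open>volume_potential_split\<close>), where the first term is continuous in \<open>t > s\<close> and the second is \<open>O(t-s)\<close>.\<close>

section \<open>Markov kernels and their action on bounded functions\<close>

locale markov_kernel =
  fixes \<Gamma> :: "real ^ 'n::finite \<Rightarrow> real ^ 'n \<Rightarrow> real \<Rightarrow> real"
  assumes continuous: "continuous_on {(x, y, t). 0 < t} (\<lambda>(x, y, t). \<Gamma> x y t)"
    and positive: "\<And>x y t. 0 < t \<Longrightarrow> 0 < \<Gamma> x y t"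
    and mass_one: "\<And>x t. 0 < t \<Longrightarrow> (LINT y|lborel. \<Gamma> x y t) = 1"
    and chapman_kolmogorov: "\<And>x y s t. 0 < s \<Longrightarrow> s < t \<Longrightarrow>
          \<Gamma> x y t = (LINT \<xi>|lborel. \<Gamma> x \<xi> (t - s) * \<Gamma> \<xi> y s)"
    and kernel_op_bcontfun: "\<And>v t. 0 < t \<Longrightarrow> kernel_op \<Gamma> t (apply_bcontfun v) \<in> bcontfun"
    and semigroup_continuous: "\<And>v. continuous_on {0<..} (\<lambda>t. semigroup_S \<Gamma> t v)"

lemma kernel_properties_imp_markov_kernel:
  assumes "kernel_properties \<omega> \<alpha> \<Gamma>"
  shows "markov_kernel \<Gamma>"
proof
  show "continuous_on {(x, y, t). 0 < t} (\<lambda>(x, y, t). \<Gamma> x y t)"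
    using assms unfolding kernel_properties_def
    by (auto elim!: continuous_on_subset)
qed (use assms in \<open>auto simp: kernel_properties_def\<close>)

context markov_kernel
begin

text \<open>The kernel is controlled at positive times only, and the times at which it is evaluated below depend
on an integration variable; the cut-off makes such compositions measurable.\<close>

lemma kernel_measurable:
  assumes [measurable]: "X \<in> borel_measurable M" "Y \<in> borel_measurable M" "T \<in> borel_measurable M"
  shows "(\<lambda>w. indicator {0<..} (T w) * \<Gamma> (X w) (Y w) (T w)) \<in> borel_measurable M"
proof -
  have "open {z :: (real^'n) \<times> (real^'n) \<times> real. 0 < snd (snd z)}"
    by (intro open_Collect_less continuous_intros)
  then have "{(x :: real^'n, y :: real^'n, t :: real). 0 < t} \<in> sets borel"
    by (simp add: case_prod_unfold)
  from borel_measurable_continuous_on_indicator[OF this continuous]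
  have [measurable]: "(\<lambda>z. indicator {(x, y, t). 0 < t} z *\<^sub>R (case z of (x, y, t) \<Rightarrow> \<Gamma> x y t))
      \<in> borel_measurable borel" .
  have "(\<lambda>w. (\<lambda>z. indicator {(x, y, t). 0 < t} z *\<^sub>R (case z of (x, y, t) \<Rightarrow> \<Gamma> x y t)) (X w, Y w, T w))
      \<in> borel_measurable M"
    by measurable
  then show ?thesis by (simp add: indicator_def)
qed

lemma kernel_measurable_pos:
  assumes "X \<in> borel_measurable M" "Y \<in> borel_measurable M" "0 < t"
  shows "(\<lambda>w. \<Gamma> (X w) (Y w) t) \<in> borel_measurable M"
  using kernel_measurable[OF assms(1,2), of "\<lambda>_. t"] assms(3) by simp

lemma kernel_integrable: "0 < t \<Longrightarrow> integrable lborel (\<lambda>y. \<Gamma> x y t)"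
  using mass_one[of t x] not_integrable_integral_eq by fastforce

lemma kernel_op_integrable:
  assumes t: "0 < t" and [measurable]: "\<psi> \<in> borel_measurable borel" and b: "\<And>y. \<bar>\<psi> y\<bar> \<le> C"
  shows "integrable lborel (\<lambda>y. \<Gamma> x y t * \<psi> y)"
proof (rule Bochner_Integration.integrable_bound)
  show "integrable lborel (\<lambda>y. \<Gamma> x y t * C)" using kernel_integrable[OF t] by simp
  have [measurable]: "(\<lambda>y. \<Gamma> x y t) \<in> borel_measurable borel"
    by (rule kernel_measurable_pos) (use t in auto)
  show "(\<lambda>y. \<Gamma> x y t * \<psi> y) \<in> borel_measurable lborel" by measurable
  show "AE y in lborel. norm (\<Gamma> x y t * \<psi> y) \<le> norm (\<Gamma> x y t * C)"
    using b positive[OF t] by (auto simp: abs_mult intro!: mult_mono order_trans[OF b])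
qed

lemma kernel_op_abs_le:
  assumes t: "0 < t" and b: "\<And>y. \<bar>\<psi> y\<bar> \<le> C"
  shows "\<bar>kernel_op \<Gamma> t \<psi> x\<bar> \<le> C"
proof (cases "integrable lborel (\<lambda>y. \<Gamma> x y t * \<psi> y)")
  case True
  have "norm (LINT y|lborel. \<Gamma> x y t * \<psi> y) \<le> (LINT y|lborel. \<Gamma> x y t * C)"
  proof (intro Bochner_Integration.integral_norm_bound_integral True)
    show "norm (\<Gamma> x y t * \<psi> y) \<le> \<Gamma> x y t * C" for y
      using b[of y] positive[OF t, of x y] by (simp add: abs_mult)
  qed (use kernel_integrable[OF t] in auto)
  then show ?thesis by (simp add: kernel_op_def mass_one[OF t])
next
  case False
  then show ?thesis using b[of 0] by (simp add: kernel_op_def not_integrable_integral_eq)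
qed

lemma kernel_op_mono:
  assumes t: "0 < t" and m: "\<psi>1 \<in> borel_measurable borel" "\<psi>2 \<in> borel_measurable borel"
    and b: "\<And>y. \<bar>\<psi>1 y\<bar> \<le> C" "\<And>y. \<bar>\<psi>2 y\<bar> \<le> C" and le: "\<And>y. \<psi>1 y \<le> \<psi>2 y"
  shows "kernel_op \<Gamma> t \<psi>1 x \<le> kernel_op \<Gamma> t \<psi>2 x"
  unfolding kernel_op_def
  using positive[OF t] le
  by (intro integral_mono kernel_op_integrable[OF t m(1) b(1)] kernel_op_integrable[OF t m(2) b(2)])
    (auto intro: mult_left_mono less_imp_le)

lemma kernel_op_nonneg: "0 < t \<Longrightarrow> (\<And>y. 0 \<le> \<psi> y) \<Longrightarrow> 0 \<le> kernel_op \<Gamma> t \<psi> x"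
  unfolding kernel_op_def by (intro integral_nonneg_AE AE_I2 mult_nonneg_nonneg less_imp_le[OF positive])

lemma kernel_op_add:
  assumes t: "0 < t" and m: "\<psi>1 \<in> borel_measurable borel" "\<psi>2 \<in> borel_measurable borel"
    and b: "\<And>y. \<bar>\<psi>1 y\<bar> \<le> C1" "\<And>y. \<bar>\<psi>2 y\<bar> \<le> C2"
  shows "kernel_op \<Gamma> t (\<lambda>y. \<psi>1 y + \<psi>2 y) x = kernel_op \<Gamma> t \<psi>1 x + kernel_op \<Gamma> t \<psi>2 x"
  unfolding kernel_op_def distrib_left
  by (intro Bochner_Integration.integral_add kernel_op_integrable[OF t m(1) b(1)] kernel_op_integrable[OF t m(2) b(2)])

lemma kernel_op_cmult: "kernel_op \<Gamma> t (\<lambda>y. c * \<psi> y) x = c * kernel_op \<Gamma> t \<psi> x"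
  unfolding kernel_op_def by (simp add: mult.left_commute)

lemma apply_bcontfun_borel: "apply_bcontfun (v :: (real ^ 'n) \<Rightarrow>\<^sub>C real) \<in> borel_measurable borel"
  by (rule borel_measurable_continuous_onI) simp

lemma apply_bcontfun_abs_le: "\<bar>apply_bcontfun (v :: (real ^ 'n) \<Rightarrow>\<^sub>C real) y\<bar> \<le> norm v"
  using norm_bounded[of v y] by simp

lemma kernel_op_diff:
  assumes t: "0 < t"
  shows "kernel_op \<Gamma> t (apply_bcontfun (v - w)) x
      = kernel_op \<Gamma> t (apply_bcontfun v) x - kernel_op \<Gamma> t (apply_bcontfun w) x"
proof -
  have m: "apply_bcontfun v \<in> borel_measurable borel" for v :: "(real ^ 'n) \<Rightarrow>\<^sub>C real"
    by (rule borel_measurable_continuous_onI) simp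
  have b: "\<bar>apply_bcontfun v y\<bar> \<le> norm v" for v :: "(real ^ 'n) \<Rightarrow>\<^sub>C real" and y
    using norm_bounded[of v y] by simp
  have "kernel_op \<Gamma> t (\<lambda>y. apply_bcontfun (v - w) y + apply_bcontfun w y) x
      = kernel_op \<Gamma> t (apply_bcontfun (v - w)) x + kernel_op \<Gamma> t (apply_bcontfun w) x"
    by (rule kernel_op_add[OF t m m b b])
  then show ?thesis by simp
qed

lemma kernel_op_preserves_bcontfun:
  assumes "0 < t" "\<psi> \<in> bcontfun"
  shows "kernel_op \<Gamma> t \<psi> \<in> bcontfun"
  using kernel_op_bcontfun[OF assms(1), of "Bcontfun \<psi>"] assms(2) by (simp add: Bcontfun_inverse)

lemma semigroup_S_apply: "0 < t \<Longrightarrow> semigroup_S \<Gamma> t v x = kernel_op \<Gamma> t (apply_bcontfun v) x"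
  unfolding semigroup_S_def by (simp add: Bcontfun_inverse kernel_op_bcontfun)

lemma semigroup_S_scaleR: "0 < t \<Longrightarrow> semigroup_S \<Gamma> t (c *\<^sub>R v) = c *\<^sub>R semigroup_S \<Gamma> t v"
  by (rule bcontfun_eqI) (simp add: semigroup_S_apply kernel_op_cmult[symmetric])

lemma semigroup_S_norm_le:
  assumes t: "0 < t"
  shows "norm (semigroup_S \<Gamma> t v) \<le> norm v"
  by (rule norm_bound)
    (use norm_bounded[of v] in \<open>auto simp: semigroup_S_apply[OF t] intro!: kernel_op_abs_le[OF t]\<close>)

text \<open>Contractivity of \<open>S(r)\<close> takes care of the change in \<open>v\<close>, continuity of the semigroup at the positive
time \<open>r\<^sub>0\<close> of the change in \<open>r\<close>.\<close>

lemma kernel_op_tendsto: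
  assumes v: "(v \<longlongrightarrow> v0) F" and r: "(r \<longlongrightarrow> r0) F" "0 < r0"
  shows "((\<lambda>\<sigma>. kernel_op \<Gamma> (r \<sigma>) (apply_bcontfun (v \<sigma>)) x) \<longlongrightarrow> kernel_op \<Gamma> r0 (apply_bcontfun v0) x) F"
proof -
  have ev: "\<forall>\<^sub>F \<sigma> in F. 0 < r \<sigma>" using r by (rule order_tendstoD(1))
  have "((\<lambda>\<sigma>. semigroup_S \<Gamma> (r \<sigma>) v0) \<longlongrightarrow> semigroup_S \<Gamma> r0 v0) F"
    by (rule continuous_on_tendsto_compose[OF semigroup_continuous[of v0] r(1)]) (use r ev in auto)
  then have "((\<lambda>\<sigma>. semigroup_S \<Gamma> (r \<sigma>) v0 - semigroup_S \<Gamma> r0 v0) \<longlongrightarrow> 0) F" by (rule Lim_null[THEN iffD1])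
  then have "((\<lambda>\<sigma>. norm (v \<sigma> - v0) + norm (semigroup_S \<Gamma> (r \<sigma>) v0 - semigroup_S \<Gamma> r0 v0)) \<longlongrightarrow> 0 + 0) F"
    by (intro tendsto_add tendsto_norm_zero v[THEN Lim_null[THEN iffD1]])
  then have z: "((\<lambda>\<sigma>. norm (v \<sigma> - v0) + norm (semigroup_S \<Gamma> (r \<sigma>) v0 - semigroup_S \<Gamma> r0 v0)) \<longlongrightarrow> 0) F" by simp
  have "((\<lambda>\<sigma>. kernel_op \<Gamma> (r \<sigma>) (apply_bcontfun (v \<sigma>)) x - kernel_op \<Gamma> r0 (apply_bcontfun v0) x) \<longlongrightarrow> 0) F"
  proof (rule Lim_null_comparison[OF _ z])
    show "\<forall>\<^sub>F \<sigma> in F. norm (kernel_op \<Gamma> (r \<sigma>) (apply_bcontfun (v \<sigma>)) x - kernel_op \<Gamma> r0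
        (apply_bcontfun v0) x)
        \<le> norm (v \<sigma> - v0) + norm (semigroup_S \<Gamma> (r \<sigma>) v0 - semigroup_S \<Gamma> r0 v0)"
      using ev
    proof eventually_elim
      case (elim \<sigma>)
      have "\<bar>kernel_op \<Gamma> (r \<sigma>) (apply_bcontfun (v \<sigma> - v0)) x\<bar> \<le> norm (v \<sigma> - v0)"
        by (rule kernel_op_abs_le[OF elim]) (use norm_bounded[of "v \<sigma> - v0"] in simp)
      moreover have "\<bar>semigroup_S \<Gamma> (r \<sigma>) v0 x - semigroup_S \<Gamma> r0 v0 x\<bar>
          \<le> norm (semigroup_S \<Gamma> (r \<sigma>) v0 - semigroup_S \<Gamma> r0 v0)"
        using norm_bounded[of "semigroup_S \<Gamma> (r \<sigma>) v0 - semigroup_S \<Gamma> r0 v0" x] by simp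
      ultimately show ?case
        unfolding kernel_op_diff[OF elim] semigroup_S_apply[OF elim] semigroup_S_apply[OF r(2)] real_norm_def by linarith
    qed
  qed
  then show ?thesis by (rule Lim_null[THEN iffD2])
qed

text \<open>If the integral vanished, so would \<open>v\<close> almost everywhere, because the kernel is strictly positive; but
the open set where \<open>v > 0\<close> is nonempty and hence not a null set.\<close>

lemma kernel_op_pos:
  assumes t: "0 < t" and v: "\<And>y. 0 \<le> apply_bcontfun v y" "v \<noteq> 0"
  shows "0 < kernel_op \<Gamma> t (apply_bcontfun v) x"
proof (rule ccontr)
  have b: "\<bar>apply_bcontfun v y\<bar> \<le> norm v" for y
    using norm_bounded[of v y] by simp
  have i: "integrable lborel (\<lambda>y. \<Gamma> x y t * apply_bcontfun v y)"
    by (rule kernel_op_integrable[OF t _ b]) (rule borel_measurable_continuous_onI, simp)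
  assume "\<not> 0 < kernel_op \<Gamma> t (apply_bcontfun v) x"
  moreover have nn: "0 \<le> \<Gamma> x y t * apply_bcontfun v y" for y
    using positive[OF t, of x y] v(1)[of y] by simp
  ultimately have "(LINT y|lborel. \<Gamma> x y t * apply_bcontfun v y) = 0"
    using kernel_op_nonneg[OF t, of "apply_bcontfun v" x] v(1)
        by (auto simp: kernel_op_def not_less intro: antisym)
  then have "AE y in lborel. \<Gamma> x y t * apply_bcontfun v y = 0"
    using integral_nonneg_eq_0_iff_AE[OF i] nn by simp
  then have "AE y in lborel. y \<notin> {y. 0 < apply_bcontfun v y}"
    by eventually_elim (use positive[OF t, of x] in \<open>auto simp: less_le\<close>)
  moreover have op: "open {y. 0 < apply_bcontfun v y}"
    by (intro open_Collect_less continuous_intros) auto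
  ultimately have "{y. 0 < apply_bcontfun v y} \<in> null_sets lborel"
    by (subst (asm) AE_iff_null_sets[symmetric]) auto
  then have "negligible {y. 0 < apply_bcontfun v y}"
    by (simp add: negligible_iff_null_sets null_sets_completionI)
  then have "{y. 0 < apply_bcontfun v y} = {}" using open_not_negligible[OF op] by blast
  then have "apply_bcontfun v y = 0" for y
    using v(1)[of y] by (metis (mono_tags, lifting) empty_iff le_less mem_Collect_eq)
  then have "v = 0" by (intro bcontfun_eqI) simp
  then show False using v(2) by simp
qed

lemma integrable_kernel_mult:
  assumes r: "0 < r" and q: "q \<in> borel_measurable (borel \<Otimes>\<^sub>M borel)" 
    and qi: "\<And>z. integrable N (\<lambda>w. q (z, w))" and qb: "\<And>z. (LINT w|N. \<bar>q (z, w)\<bar>) \<le> C"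
    and N[simp]: "sigma_finite_measure N" "sets N = sets (borel :: 'b::second_countable_topology measure)"
  shows "integrable (lborel \<Otimes>\<^sub>M N) (\<lambda>(z, w). \<Gamma> x z r * q (z, w))"
proof -
  interpret N: sigma_finite_measure N by fact
  interpret pair_sigma_finite lborel N ..
  have [measurable]: "(\<lambda>y. \<Gamma> x y r) \<in> borel_measurable borel"
    by (rule kernel_measurable_pos) (use r in auto)
  have [measurable]: "q \<in> borel_measurable (lborel \<Otimes>\<^sub>M N)"
    using q by (simp cong: measurable_cong_sets sets_pair_measure_cong)
  show ?thesis
  proof (rule Fubini_integrable)
    show "AE z in lborel. integrable N (\<lambda>w. case (z, w) of (z, w) \<Rightarrow> \<Gamma> x z r * q (z, w))"
      using qi by simp
    have "integrable lborel (\<lambda>z. \<Gamma> x z r * (LINT w|N. \<bar>q (z, w)\<bar>))"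
    proof (rule kernel_op_integrable[OF r])
      have "(\<lambda>z. LINT w|N. \<bar>q (z, w)\<bar>) \<in> borel_measurable lborel" by measurable
      then show "(\<lambda>z. LINT w|N. \<bar>q (z, w)\<bar>) \<in> borel_measurable borel" by simp
      show "\<bar>LINT w|N. \<bar>q (y, w)\<bar>\<bar> \<le> C" for y
        using qb[of y] by (simp add: integral_nonneg_AE)
    qed
    then show "integrable lborel (\<lambda>z. LINT w|N. norm (case (z, w) of (z, w) \<Rightarrow> \<Gamma> x z r * q (z, w)))"
      using positive[OF r] by (simp add: abs_mult abs_of_pos)
  qed measurable
qed

text \<open>Used with the parameter \<open>w\<close> in space (semigroup law) and in time (Duhamel integral).\<close>

lemma kernel_op_Fubini:
  assumes r: "0 < r" and q: "q \<in> borel_measurable (borel \<Otimes>\<^sub>M borel)" 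
    and qi: "\<And>z. integrable N (\<lambda>w. q (z, w))" and qb: "\<And>z. (LINT w|N. \<bar>q (z, w)\<bar>) \<le> C"
    and N: "sigma_finite_measure N" "sets N = sets (borel :: 'b::second_countable_topology measure)"
  shows "kernel_op \<Gamma> r (\<lambda>z. LINT w|N. q (z, w)) x = (LINT w|N. kernel_op \<Gamma> r (\<lambda>z. q (z, w)) x)"
proof -
  interpret N: sigma_finite_measure N by fact
  interpret pair_sigma_finite lborel N ..
  show ?thesis
    using Fubini_integral[OF integrable_kernel_mult[OF assms]]
    by (simp add: kernel_op_def)
qed

text \<open>The semigroup law. Stated for bounded Borel functions since it is applied to sources inside an
integral as well as to elements of \<open>C\<^sub>b\<close>.\<close>

lemma kernel_op_kernel_op:
  assumes r: "0 < r" and s: "0 < s" and m[measurable]: "\<psi> \<in> borel_measurable borel" and b: "\<And>y. \<bar>\<psi> y\<bar> \<le> C"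
  shows "kernel_op \<Gamma> r (kernel_op \<Gamma> s \<psi>) x = kernel_op \<Gamma> (r + s) \<psi> x"
proof -
  have "kernel_op \<Gamma> r (\<lambda>z. LINT y|lborel. (\<lambda>(z, y). \<Gamma> z y s * \<psi> y) (z, y)) x
      = (LINT y|lborel. kernel_op \<Gamma> r (\<lambda>z. (\<lambda>(z, y). \<Gamma> z y s * \<psi> y) (z, y)) x)"
  proof (rule kernel_op_Fubini[OF r])
    have [measurable]: "(\<lambda>p. \<Gamma> (fst p) (snd p) s) \<in> borel_measurable (borel \<Otimes>\<^sub>M borel)"
      by (rule kernel_measurable_pos) (use s in auto)
    show "(\<lambda>(z, y). \<Gamma> z y s * \<psi> y) \<in> borel_measurable (borel \<Otimes>\<^sub>M borel)"
      unfolding case_prod_unfold by measurable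
    show "integrable lborel (\<lambda>y. (\<lambda>(z, y). \<Gamma> z y s * \<psi> y) (z, y))" for z
      using kernel_op_integrable[OF s m b] by simp
    have "kernel_op \<Gamma> s (\<lambda>y. \<bar>\<psi> y\<bar>) z \<le> C" for z
      using kernel_op_abs_le[OF s, of "\<lambda>y. \<bar>\<psi> y\<bar>" C z] b by simp
    then show "(LINT y|lborel. \<bar>(\<lambda>(z, y). \<Gamma> z y s * \<psi> y) (z, y)\<bar>) \<le> C" for z
      using positive[OF s] by (simp add: kernel_op_def abs_mult abs_of_pos)
  qed (auto simp: lborel.sigma_finite_measure_axioms)
  moreover have "kernel_op \<Gamma> r (\<lambda>z. \<Gamma> z y s * \<psi> y) x = \<Gamma> x y (r + s) * \<psi> y" for y
    using chapman_kolmogorov[of s "r + s" x y] r s by (simp add: kernel_op_def mult.assoc[symmetric])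
  ultimately show ?thesis by (simp add: kernel_op_def[abs_def])
qed

end

section \<open>The volume potential of a time-dependent source\<close>

text \<open>Duhamel's integral for a prescribed source \<open>\<phi>\<close>, so that its linear theory does not refer to the
nonlinearity.\<close>

definition volume_potential ::
    "(real ^ 'n::finite \<Rightarrow> real ^ 'n \<Rightarrow> real \<Rightarrow> real) \<Rightarrow> (real \<Rightarrow> real ^ 'n \<Rightarrow> real) \<Rightarrow> real \<Rightarrow> real ^ 'n \<Rightarrow> real"
  where "volume_potential \<Gamma> \<phi> t x = (LINT \<sigma>:{0<..<t}|lborel. kernel_op \<Gamma> (t - \<sigma>) (\<phi> \<sigma>) x)"

lemma duhamel_eq_volume_potential:
  "duhamel \<Gamma> h f u = volume_potential \<Gamma> (\<lambda>\<sigma> y. h \<sigma> * f (u \<sigma> y))"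
  by (intro ext) (simp add: duhamel_def volume_potential_def)

text \<open>Sources are prescribed on the time interval \<open>(0,T)\<close> only, hence the cut-off. Joint measurability is what
Fubini's theorem needs, and the bound makes all integrals over \<open>(0,T)\<close> converge.\<close>

definition source_upto :: "real \<Rightarrow> real \<Rightarrow> (real \<Rightarrow> real ^ 'n::finite \<Rightarrow> real) \<Rightarrow> bool" where
  "source_upto T C \<phi> \<longleftrightarrow>
     (\<lambda>(\<sigma>, y). indicator {0<..<T} \<sigma> * \<phi> \<sigma> y) \<in> borel_measurable (borel \<Otimes>\<^sub>M borel) \<and>
     (\<forall>\<sigma> y. 0 < \<sigma> \<and> \<sigma> < T \<longrightarrow> \<bar>\<phi> \<sigma> y\<bar> \<le> C)"

lemma source_bound: "source_upto T C \<phi> \<Longrightarrow> 0 < \<sigma> \<Longrightarrow> \<sigma> < T \<Longrightarrow> \<bar>\<phi> \<sigma> y\<bar> \<le> C"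
  by (simp add: source_upto_def)

lemma source_nonneg_bound:
  assumes \<phi>: "source_upto T C \<phi>" and s: "0 < s" "s \<le> T"
  shows "0 \<le> C"
  using source_bound[OF \<phi>, of "s/2" 0] s by simp

lemma source_measurable:
  assumes "source_upto T C \<phi>" and X: "X \<in> borel_measurable M" and Y: "Y \<in> borel_measurable M"
  shows "(\<lambda>w. indicator {0<..<T} (X w) * \<phi> (X w) (Y w)) \<in> borel_measurable M"
proof -
  have [measurable]: "(\<lambda>(\<sigma>, y). indicator {0<..<T} \<sigma> * \<phi> \<sigma> y) \<in> borel_measurable (borel \<Otimes>\<^sub>M borel)"
    using assms by (simp add: source_upto_def)
  note [measurable] = X Y
  have "(\<lambda>w. (\<lambda>(\<sigma>, y). indicator {0<..<T} \<sigma> * \<phi> \<sigma> y) (X w, Y w)) \<in> borel_measurable M"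
    by measurable
  then show ?thesis by simp
qed

lemma source_slice_measurable:
  assumes "source_upto T C \<phi>" "0 < \<sigma>" "\<sigma> < T"
  shows "\<phi> \<sigma> \<in> borel_measurable borel"
  using source_measurable[OF assms(1), of "\<lambda>_. \<sigma>" borel "\<lambda>y. y"] assms(2,3) by simp

lemma source_cmult:
  assumes \<phi>: "source_upto T C \<phi>"
  shows "source_upto T (\<bar>c\<bar> * C) (\<lambda>\<sigma> y. c * \<phi> \<sigma> y)"
  unfolding source_upto_def
proof (intro conjI allI impI)
  have "(\<lambda>p. c * (indicator {0<..<T} (fst p) * \<phi> (fst p) (snd p))) \<in> borel_measurable (borel \<Otimes>\<^sub>M borel)"
    by (intro borel_measurable_times borel_measurable_const source_measurable[OF \<phi>]) auto
  then show "(\<lambda>(\<sigma>, y). indicator {0<..<T} \<sigma> * (c * \<phi> \<sigma> y)) \<in> borel_measurable (borel \<Otimes>\<^sub>M borel)"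
    by (simp add: case_prod_unfold mult.left_commute)
  show "\<bar>c * \<phi> \<sigma> y\<bar> \<le> \<bar>c\<bar> * C" if "0 < \<sigma> \<and> \<sigma> < T" for \<sigma> y
    using source_bound[OF \<phi>, of \<sigma> y] that by (simp add: abs_mult mult_left_mono)
qed

context markov_kernel
begin

lemma volume_potential_integrand_measurable:
  assumes \<phi>: "source_upto T C \<phi>" and sT: "s \<le> T" "s \<le> t"
  shows "(\<lambda>(x, \<sigma>). indicator {0<..<s} \<sigma> * kernel_op \<Gamma> (t - \<sigma>) (\<phi> \<sigma>) x) \<in> borel_measurable (borel \<Otimes>\<^sub>M borel)"
proof -
  have *: "(\<lambda>(x, \<sigma>). indicator {0<..<s} \<sigma> * kernel_op \<Gamma> (t - \<sigma>) (\<phi> \<sigma>) x)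
     = (\<lambda>p. LINT y|lborel. indicator {0<..<s} (snd p) *
           (indicator {0<..} (t - snd p) * \<Gamma> (fst p) y (t - snd p)) *
           (indicator {0<..<T} (snd p) * \<phi> (snd p) y))"
    using sT by (auto simp: fun_eq_iff indicator_def kernel_op_def)
  have 1[measurable]: "(\<lambda>w. indicator {0<..} (t - snd (fst w)) * \<Gamma> (fst (fst w)) (snd w) (t - snd (fst w)))
     \<in> borel_measurable ((borel \<Otimes>\<^sub>M borel) \<Otimes>\<^sub>M lborel)"
    by (rule kernel_measurable) measurable
  have 2[measurable]: "(\<lambda>w. indicator {0<..<T} (snd (fst w)) * \<phi> (snd (fst w)) (snd w))
     \<in> borel_measurable ((borel \<Otimes>\<^sub>M borel) \<Otimes>\<^sub>M lborel)"
    by (rule source_measurable[OF \<phi>]) measurable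
  show ?thesis
    unfolding * by (rule lborel.borel_measurable_lebesgue_integral) (unfold case_prod_unfold, measurable)
qed

lemma volume_potential_integrable:
  assumes \<phi>: "source_upto T C \<phi>" and s: "s \<le> T" "s \<le> t"
  shows "set_integrable lborel {0<..<s} (\<lambda>\<sigma>. kernel_op \<Gamma> (t - \<sigma>) (\<phi> \<sigma>) x)"
proof -
  have "integrable lborel (\<lambda>\<sigma>. indicator {0<..<s} \<sigma> * kernel_op \<Gamma> (t - \<sigma>) (\<phi> \<sigma>) x)"
  proof (rule Bochner_Integration.integrable_bound)
    show "integrable lborel (\<lambda>\<sigma>. indicator {0<..<s} \<sigma> * C)"
      by (cases "0 < s") (auto simp: ennreal_indicator)
    have [measurable]: "(\<lambda>(x, \<sigma>). indicator {0<..<s} \<sigma> * kernel_op \<Gamma> (t - \<sigma>) (\<phi> \<sigma>) x)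
        \<in> borel_measurable (borel \<Otimes>\<^sub>M borel)"
      by (rule volume_potential_integrand_measurable[OF assms])
    have "(\<lambda>\<sigma>. (\<lambda>(x, \<sigma>). indicator {0<..<s} \<sigma> * kernel_op \<Gamma> (t - \<sigma>) (\<phi> \<sigma>) x) (x, \<sigma>))
        \<in> borel_measurable borel"
      by measurable
    then show "(\<lambda>\<sigma>. indicator {0<..<s} \<sigma> * kernel_op \<Gamma> (t - \<sigma>) (\<phi> \<sigma>) x) \<in> borel_measurable lborel"
      by simp
    have "\<bar>kernel_op \<Gamma> (t - \<sigma>) (\<phi> \<sigma>) x\<bar> \<le> \<bar>C\<bar>" if "0 < \<sigma>" "\<sigma> < s" for \<sigma>
      by (rule order_trans[OF kernel_op_abs_le[of "t - \<sigma>" "\<phi> \<sigma>" C x]])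
          (use s that source_bound[OF \<phi>] in auto)
    then show "AE \<sigma> in lborel. norm (indicator {0<..<s} \<sigma> * kernel_op \<Gamma> (t - \<sigma>) (\<phi> \<sigma>) x)
        \<le> norm (indicator {0<..<s} \<sigma> * C)"
      by (auto simp: indicator_def)
  qed
  then show ?thesis by (simp add: set_integrable_def)
qed

lemma kernel_op_time_integral_le:
  assumes \<phi>: "source_upto T C \<phi>" and t: "t \<le> T" and s: "0 \<le> r" "r < s" "s \<le> t"
  shows "\<bar>LINT \<sigma>:{r<..<s}|lborel. kernel_op \<Gamma> (t - \<sigma>) (\<phi> \<sigma>) x\<bar> \<le> C * (s - r)"
proof -
  have i: "set_integrable lborel {r<..<s} (\<lambda>\<sigma>. kernel_op \<Gamma> (t - \<sigma>) (\<phi> \<sigma>) x)"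
    by (rule set_integrable_subset[OF volume_potential_integrable[OF \<phi>, of s t]]) (use s t in auto)
  have "norm (LINT \<sigma>:{r<..<s}|lborel. kernel_op \<Gamma> (t - \<sigma>) (\<phi> \<sigma>) x)
      \<le> (LINT \<sigma>|lborel. indicator {r<..<s} \<sigma> * C)"
    unfolding set_lebesgue_integral_def
  proof (rule Bochner_Integration.integral_norm_bound_integral)
    show "integrable lborel (\<lambda>\<sigma>. indicat_real {r<..<s} \<sigma> *\<^sub>R kernel_op \<Gamma> (t - \<sigma>) (\<phi> \<sigma>) x)"
      using i by (simp add: set_integrable_def)
    show "norm (indicat_real {r<..<s} \<sigma> *\<^sub>R kernel_op \<Gamma> (t - \<sigma>) (\<phi> \<sigma>) x) \<le> indicator {r<..<s} \<sigma> * C" for \<sigma>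
      using kernel_op_abs_le[of "t - \<sigma>" "\<phi> \<sigma>" C x] source_bound[OF \<phi>, of \<sigma>] s t
      by (auto simp: indicator_def)
  qed (use s in auto)
  then show ?thesis using s by (simp add: mult.commute)
qed

lemma volume_potential_abs_le:
  assumes \<phi>: "source_upto T C \<phi>" and t: "0 < t" "t \<le> T"
  shows "\<bar>volume_potential \<Gamma> \<phi> t x\<bar> \<le> C * t"
  using kernel_op_time_integral_le[OF \<phi>, of t 0 t x] t by (simp add: volume_potential_def)

lemma volume_potential_nonneg:
  assumes "\<And>\<sigma> y. 0 < \<sigma> \<Longrightarrow> \<sigma> < t \<Longrightarrow> 0 \<le> \<phi> \<sigma> y"
  shows "0 \<le> volume_potential \<Gamma> \<phi> t x"
  unfolding volume_potential_def set_lebesgue_integral_def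
  by (intro integral_nonneg_AE AE_I2) (use assms in \<open>auto simp: indicator_def intro!: kernel_op_nonneg\<close>)

lemma volume_potential_le:
  assumes \<phi>: "source_upto T C \<phi>" and t: "t \<le> T"
    and k: "set_integrable lborel {0<..<t} k"
    and le: "\<And>\<sigma>. 0 < \<sigma> \<Longrightarrow> \<sigma> < t \<Longrightarrow> kernel_op \<Gamma> (t - \<sigma>) (\<phi> \<sigma>) x \<le> k \<sigma>"
  shows "volume_potential \<Gamma> \<phi> t x \<le> (LINT \<sigma>:{0<..<t}|lborel. k \<sigma>)"
  unfolding volume_potential_def
  by (rule set_integral_mono[OF volume_potential_integrable[OF \<phi> t order_refl] k]) (use le in auto)

lemma volume_potential_cmult:
  "volume_potential \<Gamma> (\<lambda>\<sigma> y. c * \<phi> \<sigma> y) t x = c * volume_potential \<Gamma> \<phi> t x"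
  by (simp add: volume_potential_def kernel_op_cmult)

lemma volume_potential_add:
  assumes \<phi>: "source_upto T C1 \<phi>1" "source_upto T C2 \<phi>2" and t: "t \<le> T"
  shows "volume_potential \<Gamma> (\<lambda>\<sigma> y. \<phi>1 \<sigma> y + \<phi>2 \<sigma> y) t x
      = volume_potential \<Gamma> \<phi>1 t x + volume_potential \<Gamma> \<phi>2 t x"
proof -
  have "volume_potential \<Gamma> (\<lambda>\<sigma> y. \<phi>1 \<sigma> y + \<phi>2 \<sigma> y) t x =
     (LINT \<sigma>:{0<..<t}|lborel. kernel_op \<Gamma> (t - \<sigma>) (\<phi>1 \<sigma>) x + kernel_op \<Gamma> (t - \<sigma>) (\<phi>2 \<sigma>) x)"
    unfolding volume_potential_def
  proof (rule set_lebesgue_integral_cong)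
    show "\<forall>\<sigma>. \<sigma> \<in> {0<..<t} \<longrightarrow> kernel_op \<Gamma> (t - \<sigma>) (\<lambda>y. \<phi>1 \<sigma> y + \<phi>2 \<sigma> y) x
        = kernel_op \<Gamma> (t - \<sigma>) (\<phi>1 \<sigma>) x + kernel_op \<Gamma> (t - \<sigma>) (\<phi>2 \<sigma>) x"
    proof (intro allI impI)
      fix \<sigma> assume "\<sigma> \<in> {0<..<t}"
      with t have \<sigma>: "0 < \<sigma>" "\<sigma> < T" "0 < t - \<sigma>" by auto
      show "kernel_op \<Gamma> (t - \<sigma>) (\<lambda>y. \<phi>1 \<sigma> y + \<phi>2 \<sigma> y) x
          = kernel_op \<Gamma> (t - \<sigma>) (\<phi>1 \<sigma>) x + kernel_op \<Gamma> (t - \<sigma>) (\<phi>2 \<sigma>) x"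
        by (rule kernel_op_add[OF \<sigma>(3) source_slice_measurable[OF \<phi>(1) \<sigma>(1,2)] source_slice_measurable[OF \<phi>(2) \<sigma>(1,2)]
             source_bound[OF \<phi>(1) \<sigma>(1,2)] source_bound[OF \<phi>(2) \<sigma>(1,2)]])
    qed
  qed simp
  also have "\<dots> = volume_potential \<Gamma> \<phi>1 t x + volume_potential \<Gamma> \<phi>2 t x"
    unfolding volume_potential_def
    by (rule set_integral_add(2)[OF volume_potential_integrable[OF \<phi>(1) t] volume_potential_integrable[OF \<phi>(2) t]]) auto
  finally show ?thesis .
qed

text \<open>The bound on the difference of the sources may depend on time; this is what produces the contraction
in a weighted norm later.\<close>

lemma volume_potential_diff_le:
  assumes \<phi>: "source_upto T C1 \<phi>1" "source_upto T C2 \<phi>2" and t: "t \<le> T"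
    and k: "set_integrable lborel {0<..<t} k"
    and le: "\<And>\<sigma> y. 0 < \<sigma> \<Longrightarrow> \<sigma> < t \<Longrightarrow> \<bar>\<phi>1 \<sigma> y - \<phi>2 \<sigma> y\<bar> \<le> k \<sigma>"
  shows "\<bar>volume_potential \<Gamma> \<phi>1 t x - volume_potential \<Gamma> \<phi>2 t x\<bar> \<le> (LINT \<sigma>:{0<..<t}|lborel. k \<sigma>)"
proof -
  have diff: "volume_potential \<Gamma> \<psi>1 t x - volume_potential \<Gamma> \<psi>2 t x \<le> (LINT \<sigma>:{0<..<t}|lborel. k \<sigma>)"
    if \<psi>: "source_upto T D1 \<psi>1" "source_upto T D2 \<psi>2"
      and le: "\<And>\<sigma> y. 0 < \<sigma> \<Longrightarrow> \<sigma> < t \<Longrightarrow> \<bar>\<psi>1 \<sigma> y - \<psi>2 \<sigma> y\<bar> \<le> k \<sigma>" for \<psi>1 \<psi>2 D1 D2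
  proof -
    note \<psi>2' = source_cmult[OF \<psi>(2), of "-1"]
    have "volume_potential \<Gamma> \<psi>1 t x - volume_potential \<Gamma> \<psi>2 t x
        = volume_potential \<Gamma> \<psi>1 t x + volume_potential \<Gamma> (\<lambda>\<sigma> y. -1 * \<psi>2 \<sigma> y) t x"
      unfolding volume_potential_cmult by simp
    also have "\<dots> = (LINT \<sigma>:{0<..<t}|lborel. kernel_op \<Gamma> (t - \<sigma>) (\<psi>1 \<sigma>) x + kernel_op \<Gamma> (t - \<sigma>)
        (\<lambda>y. -1 * \<psi>2 \<sigma> y) x)"
      unfolding volume_potential_def
      by (rule set_integral_add(2)[symmetric, OF volume_potential_integrable[OF \<psi>(1) t] volume_potential_integrable[OF \<psi>2' t]]) auto
    also have "\<dots> \<le> (LINT \<sigma>:{0<..<t}|lborel. k \<sigma>)"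
    proof (rule set_integral_mono[OF set_integral_add(1)[OF volume_potential_integrable[OF \<psi>(1) t] volume_potential_integrable[OF \<psi>2' t]] k])
      fix \<sigma> assume "\<sigma> \<in> {0<..<t}"
      with t have \<sigma>: "0 < \<sigma>" "\<sigma> < T" "0 < t - \<sigma>" by auto
      have "kernel_op \<Gamma> (t - \<sigma>) (\<lambda>y. \<psi>1 \<sigma> y + -1 * \<psi>2 \<sigma> y) x =
         kernel_op \<Gamma> (t - \<sigma>) (\<psi>1 \<sigma>) x + kernel_op \<Gamma> (t - \<sigma>) (\<lambda>y. -1 * \<psi>2 \<sigma> y) x"
        by (rule kernel_op_add[OF \<sigma>(3) source_slice_measurable[OF \<psi>(1) \<sigma>(1,2)] source_slice_measurable[OF \<psi>2' \<sigma>(1,2)]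
             source_bound[OF \<psi>(1) \<sigma>(1,2)] source_bound[OF \<psi>2' \<sigma>(1,2)]])
      moreover have "\<bar>kernel_op \<Gamma> (t - \<sigma>) (\<lambda>y. \<psi>1 \<sigma> y + -1 * \<psi>2 \<sigma> y) x\<bar> \<le> k \<sigma>"
        by (rule kernel_op_abs_le[OF \<sigma>(3)]) (use le \<sigma> in auto)
      ultimately show "kernel_op \<Gamma> (t - \<sigma>) (\<psi>1 \<sigma>) x + kernel_op \<Gamma> (t - \<sigma>) (\<lambda>y. -1 * \<psi>2 \<sigma> y) x \<le> k \<sigma>"
        by linarith
    qed auto
    finally show ?thesis .
  qed
  show ?thesis
    using diff[OF \<phi> le] diff[OF \<phi>(2,1)] le by (auto simp: abs_le_iff abs_minus_commute)
qed

text \<open>Interchange the operator with the time integral, then merge \<open>S(r)S(s-\<sigma>)\<close> into \<open>S(r+s-\<sigma>)\<close>.\<close>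

lemma kernel_op_volume_potential:
  assumes \<phi>: "source_upto T C \<phi>" and s: "0 < s" "s \<le> T" and r: "0 < r"
  shows "kernel_op \<Gamma> r (volume_potential \<Gamma> \<phi> s) x
      = (LINT \<sigma>:{0<..<s}|lborel. kernel_op \<Gamma> (r + s - \<sigma>) (\<phi> \<sigma>) x)"
proof -
  let ?q = "\<lambda>(z, \<sigma>). indicator {0<..<s} \<sigma> * kernel_op \<Gamma> (s - \<sigma>) (\<phi> \<sigma>) z"
  have i: "integrable lborel (\<lambda>\<sigma>. ?q (z, \<sigma>))" for z
    using volume_potential_integrable[OF \<phi>, of s s] s by (simp add: set_integrable_def)
  have "kernel_op \<Gamma> r (\<lambda>z. LINT \<sigma>|lborel. ?q (z, \<sigma>)) x = (LINT \<sigma>|lborel. kernel_op \<Gamma> r (\<lambda>z. ?q (z, \<sigma>)) x)"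
  proof (rule kernel_op_Fubini[OF r _ i])
    show "?q \<in> borel_measurable (borel \<Otimes>\<^sub>M borel)"
      by (rule volume_potential_integrand_measurable[OF \<phi>]) (use s in auto)
    show "(LINT \<sigma>|lborel. \<bar>?q (z, \<sigma>)\<bar>) \<le> C * s" for z
    proof -
      have "(LINT \<sigma>|lborel. \<bar>?q (z, \<sigma>)\<bar>) \<le> (LINT \<sigma>|lborel. indicator {0<..<s} \<sigma> * C)"
      proof (rule integral_mono)
        show "\<bar>?q (z, \<sigma>)\<bar> \<le> indicator {0<..<s} \<sigma> * C" for \<sigma>
          using kernel_op_abs_le[of "s - \<sigma>" "\<phi> \<sigma>" C z] source_bound[OF \<phi>, of \<sigma>] s
          by (auto simp: indicator_def)
      qed (use i s in \<open>auto intro: integrable_abs\<close>)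
      then show ?thesis using s by (simp add: mult.commute)
    qed
  qed (auto simp: lborel.sigma_finite_measure_axioms)
  moreover have "kernel_op \<Gamma> r (\<lambda>z. ?q (z, \<sigma>)) x
      = indicator {0<..<s} \<sigma> * kernel_op \<Gamma> (r + s - \<sigma>) (\<phi> \<sigma>) x" for \<sigma>
  proof (cases "0 < \<sigma> \<and> \<sigma> < s")
    case True
    then have "kernel_op \<Gamma> r (kernel_op \<Gamma> (s - \<sigma>) (\<phi> \<sigma>)) x = kernel_op \<Gamma> (r + (s - \<sigma>)) (\<phi> \<sigma>) x"
      using s r by (intro kernel_op_kernel_op[where C
          = C] source_slice_measurable[OF \<phi>] source_bound[OF \<phi>]) auto
    then show ?thesis using True by (simp add: algebra_simps)
  qed (auto simp: kernel_op_def)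
  ultimately show ?thesis
    by (simp add: volume_potential_def[abs_def] set_lebesgue_integral_def)
qed

text \<open>The contribution of the source before time \<open>s\<close> evolves by the semigroup after \<open>s\<close>.\<close>

lemma volume_potential_split:
  assumes \<phi>: "source_upto T C \<phi>" and s: "0 < s" "s < t" and t: "t \<le> T"
  shows "volume_potential \<Gamma> \<phi> t x =
    kernel_op \<Gamma> (t - s) (volume_potential \<Gamma> \<phi> s) x + (LINT \<sigma>:{s<..<t}|lborel. kernel_op \<Gamma> (t - \<sigma>) (\<phi> \<sigma>) x)"
proof -
  have i: "set_integrable lborel {0<..<t} (\<lambda>\<sigma>. kernel_op \<Gamma> (t - \<sigma>) (\<phi> \<sigma>) x)"
    using volume_potential_integrable[OF \<phi> t] by simp
  have "volume_potential \<Gamma> \<phi> t x = (LINT \<sigma>:{0<..<s} \<union> {s<..<t}|lborel. kernel_op \<Gamma> (t - \<sigma>) (\<phi> \<sigma>) x)"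
    unfolding volume_potential_def set_lebesgue_integral_def
  proof (rule integral_cong_AE)
    have "AE \<sigma> in lborel. \<sigma> \<noteq> s" by (rule AE_lborel_singleton)
    then show "AE \<sigma> in lborel. indicat_real {0<..<t} \<sigma> *\<^sub>R kernel_op \<Gamma> (t - \<sigma>) (\<phi> \<sigma>) x =
         indicat_real ({0<..<s} \<union> {s<..<t}) \<sigma> *\<^sub>R kernel_op \<Gamma> (t - \<sigma>) (\<phi> \<sigma>) x"
      by eventually_elim (use s in \<open>auto simp: indicator_def\<close>)
    have "set_integrable lborel ({0<..<s} \<union> {s<..<t}) (\<lambda>\<sigma>. kernel_op \<Gamma> (t - \<sigma>) (\<phi> \<sigma>) x)"
      by (rule set_integrable_subset[OF i]) (use s in auto)
    then show "(\<lambda>\<sigma>. indicat_real ({0<..<s} \<union> {s<..<t}) \<sigma> *\<^sub>R kernel_op \<Gamma> (t - \<sigma>) (\<phi> \<sigma>) x)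
        \<in> borel_measurable lborel"
      by (auto simp: set_integrable_def)
  qed (use i in \<open>auto simp: set_integrable_def\<close>)
  also have "\<dots> = (LINT \<sigma>:{0<..<s}|lborel. kernel_op \<Gamma> (t - \<sigma>) (\<phi> \<sigma>) x) + (LINT \<sigma>:{s<..<t}|lborel.
      kernel_op \<Gamma> (t - \<sigma>) (\<phi> \<sigma>) x)"
    by (rule set_integral_Un) (use s in \<open>auto intro!: set_integrable_subset[OF i]\<close>)
  finally show ?thesis
    using kernel_op_volume_potential[OF \<phi> s(1), of "t - s" x] s t by simp
qed

text \<open>For each \<open>\<sigma> < t\<close> the function \<open>S(t-\<sigma>)\<phi>(\<sigma>)\<close> is continuous and bounded by \<open>C\<close>, so continuity passes to the
time integral by dominated convergence.\<close>

lemma volume_potential_bcontfun: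
  assumes \<phi>: "source_upto T C \<phi>" and t: "0 < t" "t \<le> T"
    and c: "\<And>\<sigma>. 0 < \<sigma> \<Longrightarrow> \<sigma> < t \<Longrightarrow> continuous_on UNIV (\<phi> \<sigma>)"
  shows "volume_potential \<Gamma> \<phi> t \<in> bcontfun"
proof (rule bcontfun_normI)
  show "norm (volume_potential \<Gamma> \<phi> t x) \<le> C * t" for x
    using volume_potential_abs_le[OF \<phi> t] by simp
  have int: "integrable lborel (\<lambda>\<sigma>. indicator {0<..<t} \<sigma> *\<^sub>R kernel_op \<Gamma> (t - \<sigma>) (\<phi> \<sigma>) x)" for x
    using volume_potential_integrable[OF \<phi> t(2) order_refl] by (simp add: set_integrable_def)
  show "continuous_on UNIV (volume_potential \<Gamma> \<phi> t)"
    unfolding continuous_on_sequentially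
  proof (intro allI ballI impI)
    fix X :: "nat \<Rightarrow> real ^ 'n" and x assume X: "(\<forall>n. X n \<in> UNIV) \<and> X \<longlonglongrightarrow> x"
    have "(\<lambda>n. LINT \<sigma>|lborel. indicator {0<..<t} \<sigma> *\<^sub>R kernel_op \<Gamma> (t - \<sigma>) (\<phi> \<sigma>) (X n))
      \<longlonglongrightarrow> (LINT \<sigma>|lborel. indicator {0<..<t} \<sigma> *\<^sub>R kernel_op \<Gamma> (t - \<sigma>) (\<phi> \<sigma>) x)"
    proof (rule integral_dominated_convergence[where w = "\<lambda>\<sigma>. indicator {0<..<t} \<sigma> * C"])
      show "AE \<sigma> in lborel. (\<lambda>n. indicat_real {0<..<t} \<sigma> *\<^sub>R kernel_op \<Gamma> (t - \<sigma>) (\<phi> \<sigma>) (X n))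
          \<longlonglongrightarrow> indicat_real {0<..<t} \<sigma> *\<^sub>R kernel_op \<Gamma> (t - \<sigma>) (\<phi> \<sigma>) x"
      proof (rule AE_I2)
        fix \<sigma> show "(\<lambda>n. indicat_real {0<..<t} \<sigma> *\<^sub>R kernel_op \<Gamma> (t - \<sigma>) (\<phi> \<sigma>) (X n))
          \<longlonglongrightarrow> indicat_real {0<..<t} \<sigma> *\<^sub>R kernel_op \<Gamma> (t - \<sigma>) (\<phi> \<sigma>) x"
        proof (cases "0 < \<sigma> \<and> \<sigma> < t")
          case True
          then have "\<phi> \<sigma> \<in> bcontfun"
            using source_bound[OF \<phi>, of \<sigma>] t c by (intro bcontfun_normI[where b = C]) auto
          with True have "kernel_op \<Gamma> (t - \<sigma>) (\<phi> \<sigma>) \<in> bcontfun"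
            by (intro kernel_op_preserves_bcontfun) auto
          then have "continuous_on UNIV (kernel_op \<Gamma> (t - \<sigma>) (\<phi> \<sigma>))"
            by (simp add: bcontfun_def)
          then show ?thesis
            using X by (intro tendsto_intros) (auto intro: continuous_on_tendsto_compose)
        qed simp
      qed
      show "AE \<sigma> in lborel. norm (indicat_real {0<..<t} \<sigma> *\<^sub>R kernel_op \<Gamma> (t - \<sigma>) (\<phi> \<sigma>) (X n))
          \<le> indicat_real {0<..<t} \<sigma> * C" for n
        using kernel_op_abs_le[of "t - \<sigma>" "\<phi> \<sigma>" C "X n" for \<sigma>] source_bound[OF \<phi>] t
        by (auto simp: indicator_def)
    qed (use int t in auto)
    then show "(volume_potential \<Gamma> \<phi> t \<circ> X) \<longlonglongrightarrow> volume_potential \<Gamma> \<phi> t x"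
      by (simp add: volume_potential_def set_lebesgue_integral_def comp_def)
  qed
qed

text \<open>Near \<open>t\<^sub>0\<close>, split at a fixed time \<open>s\<close> slightly before \<open>t\<^sub>0\<close>. What has accumulated up to \<open>s\<close> is an element of
\<open>C\<^sub>b\<close> that has evolved for the positive time \<open>t - s\<close>, where the semigroup is norm continuous; what comes
after \<open>s\<close> is small.\<close>

lemma volume_potential_continuous:
  assumes \<phi>: "\<And>T. 0 < T \<Longrightarrow> \<exists>C. source_upto T C \<phi>"
    and c: "\<And>\<sigma>. 0 < \<sigma> \<Longrightarrow> continuous_on UNIV (\<phi> \<sigma>)"
  shows "continuous_on {0<..} (\<lambda>t. Bcontfun (volume_potential \<Gamma> \<phi> t))"
proof -
  have bc: "volume_potential \<Gamma> \<phi> t \<in> bcontfun" if t: "0 < t" for t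
  proof -
    obtain C where "source_upto t C \<phi>" using \<phi>[OF t] by blast
    then show ?thesis by (rule volume_potential_bcontfun) (use t c in auto)
  qed
  have norm_triangle: "norm (a + b - c) \<le> A + B + C"
    if "norm a \<le> A" "norm b \<le> B" "norm c \<le> C" for a b c :: "(real ^ 'n) \<Rightarrow>\<^sub>C real" and A B C
    using that norm_triangle_ineq4[of "a + b" c] norm_triangle_ineq[of a b] by linarith
  have "isCont (\<lambda>t. Bcontfun (volume_potential \<Gamma> \<phi> t)) t0" if t0: "0 < t0" for t0
    unfolding continuous_at_eps_delta dist_norm
  proof (intro allI impI)
    fix e :: real assume e: "0 < e"
    obtain C where C: "source_upto (t0 + 1) C \<phi>" using \<phi>[of "t0 + 1"] t0 by auto
    have C0: "0 \<le> C" using source_nonneg_bound[OF C, of 1] t0 by simp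
    \<comment> \<open>The source after time \<open>s = t\<^sub>0 - \<eta>\<close> contributes at most \<open>2C\<eta>\<close> at times within \<open>\<eta>\<close> of \<open>t\<^sub>0\<close>, and \<open>C\<eta> \<le> e/8\<close>.\<close>
    define \<eta> where "\<eta> = min (min (t0 / 2) 1) (e / (8 * (C + 1)))"
    have \<eta>: "0 < \<eta>" "\<eta> < t0" "\<eta> \<le> 1" "C * \<eta> \<le> e / 8"
    proof -
      show "0 < \<eta>" "\<eta> < t0" "\<eta> \<le> 1" using t0 e C0 by (auto simp: \<eta>_def)
      have "C * \<eta> \<le> (C + 1) * (e / (8 * (C + 1)))"
        using C0 e \<open>0 < \<eta>\<close> by (intro mult_mono) (auto simp: \<eta>_def)
      also have "d * (e / (8 * d)) = e / 8" if "0 < d" for d using that by simp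
      from this[of "C + 1"] have "(C + 1) * (e / (8 * (C + 1))) = e / 8" using C0 by simp
      finally show "C * \<eta> \<le> e / 8" .
    qed
    define s where "s = t0 - \<eta>"
    have s: "0 < s" "s < t0" using \<eta> by (auto simp: s_def)
    define p where "p = Bcontfun (volume_potential \<Gamma> \<phi> s)"
    have p: "apply_bcontfun p = volume_potential \<Gamma> \<phi> s"
      using bc[OF s(1)] by (simp add: p_def Bcontfun_inverse)
    have near: "norm (Bcontfun (volume_potential \<Gamma> \<phi> t) - semigroup_S \<Gamma> (t - s) p) \<le> C * (t - s)"
      if t: "s < t" "t \<le> t0 + 1" for t
    proof (rule norm_bound)
      fix x
      have "Bcontfun (volume_potential \<Gamma> \<phi> t) x = volume_potential \<Gamma> \<phi> t x"
        using bc[of t] s t by (simp add: Bcontfun_inverse)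
      moreover have "semigroup_S \<Gamma> (t - s) p x = kernel_op \<Gamma> (t - s) (volume_potential \<Gamma> \<phi> s) x"
        using t by (simp add: semigroup_S_apply p)
      ultimately have "(Bcontfun (volume_potential \<Gamma> \<phi> t) - semigroup_S \<Gamma> (t - s) p) x
          = (LINT \<sigma>:{s<..<t}|lborel. kernel_op \<Gamma> (t - \<sigma>) (\<phi> \<sigma>) x)"
        using volume_potential_split[OF C s(1) t] by simp
      then show "norm ((Bcontfun (volume_potential \<Gamma> \<phi> t) - semigroup_S \<Gamma> (t - s) p) x) \<le> C * (t - s)"
        using kernel_op_time_integral_le[OF C t(2), of s t x] s t by simp
    qed
    have "isCont (\<lambda>t. semigroup_S \<Gamma> t p) (t0 - s)"
      using semigroup_continuous[of p] s by (simp add: continuous_on_eq_continuous_at)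
    then obtain d where d: "0 < d" "\<And>r. \<bar>r - (t0 - s)\<bar> < d \<Longrightarrow>
        norm (semigroup_S \<Gamma> r p - semigroup_S \<Gamma> (t0 - s) p) < e / 8"
      using e unfolding continuous_at_eps_delta dist_norm real_norm_def
          by (metis divide_pos_pos zero_less_numeral)
    show "\<exists>d>0. \<forall>t. norm (t - t0) < d \<longrightarrow>
        norm (Bcontfun (volume_potential \<Gamma> \<phi> t) - Bcontfun (volume_potential \<Gamma> \<phi> t0)) < e"
    proof (intro exI[of _ "min d \<eta>"] conjI allI impI)
      fix t assume "norm (t - t0) < min d \<eta>"
      then have t: "\<bar>t - t0\<bar> < d" "\<bar>t - t0\<bar> < \<eta>" by auto
      have "s < t" "t \<le> t0 + 1" using t(2) \<eta> by (auto simp: s_def)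
      have 1: "norm (Bcontfun (volume_potential \<Gamma> \<phi> t) - semigroup_S \<Gamma> (t - s) p) \<le> C * (2 * \<eta>)"
        by (rule order_trans[OF near[OF \<open>s < t\<close> \<open>t \<le> t0 + 1\<close>]])
            (use t C0 in \<open>auto simp: s_def intro!: mult_left_mono\<close>)
      have 2: "norm (Bcontfun (volume_potential \<Gamma> \<phi> t0) - semigroup_S \<Gamma> (t0 - s) p) \<le> C * \<eta>"
        by (rule order_trans[OF near[of t0]]) (use s in \<open>auto simp: s_def\<close>)
      have 3: "norm (semigroup_S \<Gamma> (t - s) p - semigroup_S \<Gamma> (t0 - s) p) < e / 8"
        using d(2)[of "t - s"] t by simp
      have "Bcontfun (volume_potential \<Gamma> \<phi> t) - Bcontfun (volume_potential \<Gamma> \<phi> t0)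
         = (Bcontfun (volume_potential \<Gamma> \<phi> t) - semigroup_S \<Gamma> (t - s) p)
           + (semigroup_S \<Gamma> (t - s) p - semigroup_S \<Gamma> (t0 - s) p)
           - (Bcontfun (volume_potential \<Gamma> \<phi> t0) - semigroup_S \<Gamma> (t0 - s) p)" by simp
      also have "norm \<dots> \<le> C * (2 * \<eta>) + e / 8 + C * \<eta>"
        using norm_triangle[OF 1 less_imp_le[OF 3] 2] .
      also have "\<dots> < e" using \<eta>(4) e by simp
      finally show "norm (Bcontfun (volume_potential \<Gamma> \<phi> t) - Bcontfun (volume_potential \<Gamma> \<phi> t0)) < e" .
    qed (use d \<eta> in auto)
  qed
  then show ?thesis by (simp add: continuous_on_eq_continuous_at)
qed

end

lemma continuous_on_bcontfun_curve:
  fixes u :: "real \<Rightarrow> ((real ^ 'n::finite) \<Rightarrow>\<^sub>C real)"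
  assumes u: "continuous_on A u"
  shows "continuous_on (A \<times> UNIV) (\<lambda>p. apply_bcontfun (u (fst p)) (snd p))"
  unfolding continuous_on_def
proof
  fix p :: "real \<times> (real ^ 'n)" assume p: "p \<in> A \<times> UNIV"
  let ?F = "at p within A \<times> UNIV"
  have "continuous_on (A \<times> (UNIV :: (real ^ 'n) set)) (\<lambda>p. u (fst p))"
    by (rule continuous_on_compose2[OF u]) (auto intro: continuous_intros)
  then have 1: "((\<lambda>q. u (fst q)) \<longlongrightarrow> u (fst p)) ?F"
    using p by (auto simp: continuous_on_def)
  have "((\<lambda>q. norm (u (fst q) - u (fst p))) \<longlongrightarrow> 0) ?F"
    using tendsto_norm[OF tendsto_diff[OF 1 tendsto_const[of "u (fst p)"]]] by simp
  then have "((\<lambda>q. apply_bcontfun (u (fst q) - u (fst p)) (snd q)) \<longlongrightarrow> 0) ?F"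
    by (rule Lim_null_comparison[rotated]) (intro always_eventually allI norm_bounded)
  moreover have "((\<lambda>q. apply_bcontfun (u (fst p)) (snd q)) \<longlongrightarrow> apply_bcontfun (u (fst p)) (snd p)) ?F"
    by (rule continuous_on_tendsto_compose[OF continuous_on_apply_bcontfun[of UNIV]])
        (auto intro!: tendsto_intros)
  ultimately have "((\<lambda>q. apply_bcontfun (u (fst q) - u (fst p)) (snd q) + apply_bcontfun (u (fst p))
      (snd q))
      \<longlongrightarrow> 0 + apply_bcontfun (u (fst p)) (snd p)) ?F"
    by (rule tendsto_add)
  then show "((\<lambda>q. apply_bcontfun (u (fst q)) (snd q)) \<longlongrightarrow> apply_bcontfun (u (fst p)) (snd p)) ?F"
    by simp
qed

text \<open>A sup norm continuous curve in \<open>C\<^sub>b\<close> is jointly continuous in time and space, so the cut-off source is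
Borel; boundedness comes from compactness of \<open>[0,T] \<times> [0,m]\<close>.\<close>

lemma nonlinear_source:
  fixes u :: "real \<Rightarrow> ((real ^ 'n::finite) \<Rightarrow>\<^sub>C real)"
  assumes F: "continuous_on ({0..} \<times> {0..}) (\<lambda>p. F (fst p) (snd p))"
    and u: "continuous_on {0<..<T} u"
    and b: "\<And>\<sigma> y. 0 < \<sigma> \<Longrightarrow> \<sigma> < T \<Longrightarrow> 0 \<le> apply_bcontfun (u \<sigma>) y \<and> apply_bcontfun (u \<sigma>) y \<le> m"
  shows "\<exists>C. source_upto T C (\<lambda>\<sigma> y. F \<sigma> (apply_bcontfun (u \<sigma>) y) :: real)"
proof -
  have "continuous_on ({0..T} \<times> {0..m}) (\<lambda>p. F (fst p) (snd p))"
    by (rule continuous_on_subset[OF F]) auto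
  then have "bounded ((\<lambda>p. F (fst p) (snd p)) ` ({0..T} \<times> {0..m}))"
    by (intro compact_imp_bounded compact_continuous_image compact_Times) auto
  then obtain C where C: "\<And>\<sigma> s. 0 \<le> \<sigma> \<Longrightarrow> \<sigma> \<le> T \<Longrightarrow> 0 \<le> s \<Longrightarrow> s \<le> m \<Longrightarrow> \<bar>F \<sigma> s\<bar> \<le> C"
    by (fastforce simp: bounded_iff)
  have cont: "continuous_on ({0<..<T} \<times> UNIV) (\<lambda>p. (\<lambda>p. F (fst p) (snd p)) (fst p, apply_bcontfun (u
      (fst p)) (snd p)))"
    by (rule continuous_on_compose2[OF F])
      (use b in \<open>auto intro!: continuous_intros continuous_on_bcontfun_curve[OF u]\<close>)
  have sets: "{0<..<T} \<times> (UNIV :: (real ^ 'n) set) \<in> sets borel"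
    by (intro borel_open open_Times) auto
  from borel_measurable_continuous_on_indicator[OF sets cont]
  have "(\<lambda>p. indicator ({0<..<T} \<times> (UNIV :: (real ^ 'n) set)) p *\<^sub>R F (fst p) (apply_bcontfun (u (fst p))
      (snd p))) \<in> borel_measurable borel"
    by simp
  then have "(\<lambda>(\<sigma>, y). indicator {0<..<T} \<sigma> * F \<sigma> (apply_bcontfun (u \<sigma>) y))
      \<in> borel_measurable (borel \<Otimes>\<^sub>M borel)"
    unfolding borel_prod
    by (rule back_subst[where P = "\<lambda>f. f \<in> borel_measurable borel"]) (auto simp: fun_eq_iff indicator_def)
  then show ?thesis
    using C b by (auto simp: source_upto_def intro!: exI[of _ C])
qed

section \<open>Global solutions below the linear flow\<close>

text \<open>With the weight \<open>exp(2Lt)\<close>, integrating a Lipschitz estimate with constant \<open>L\<close> over \<open>(0,t)\<close> gains the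
factor \<open>1/2\<close>.\<close>

lemma set_integral_exp_le:
  fixes L t :: real
  assumes L: "0 < L" and t: "0 \<le> t"
  shows "(LINT \<sigma>:{0<..<t}|lborel. L * exp (2 * L * \<sigma>)) \<le> exp (2 * L * t) / 2"
    and "set_integrable lborel {0<..<t} (\<lambda>\<sigma>. L * exp (2 * L * \<sigma>))"
proof -
  show i: "set_integrable lborel {0<..<t} (\<lambda>\<sigma>. L * exp (2 * L * \<sigma>))"
    by (rule set_integrable_subset[OF borel_integrable_atLeastAtMost'[of 0 t]])
        (auto intro!: continuous_intros)
  have "((\<lambda>\<sigma>. L * exp (2 * L * \<sigma>)) has_integral exp (2 * L * t) / 2 - exp (2 * L * 0) / 2) {0..t}"
    by (rule fundamental_theorem_of_calculus[OF t])
      (auto intro!: derivative_eq_intros simp: has_real_derivative_iff_has_vector_derivative[symmetric])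
  then have "integral {0..t} (\<lambda>\<sigma>. L * exp (2 * L * \<sigma>)) = exp (2 * L * t) / 2 - exp (2 * L * 0) / 2"
    by (rule integral_unique)
  also have "\<dots> \<le> exp (2 * L * t) / 2" by simp
  finally have "integral {0..t} (\<lambda>\<sigma>. L * exp (2 * L * \<sigma>)) \<le> exp (2 * L * t) / 2" .
  then show "(LINT \<sigma>:{0<..<t}|lborel. L * exp (2 * L * \<sigma>)) \<le> exp (2 * L * t) / 2"
    unfolding set_borel_integral_eq_integral(2)[OF i] integral_open_interval_real[symmetric] .
qed

instance bcontfun :: (metric_space, banach) banach ..

context markov_kernel
begin

text \<open>The linear bound on \<open>F\<close> by \<open>k\<close>, together with \<open>\<integral> k \<le> 1 - \<delta>\<close>, keeps the Picard map inside the order interval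
\<open>0 \<le> u(t) \<le> S(t)v\<^sub>0\<close>; functions in that interval have values in \<open>[0, \<parallel>S(\<sigma>)v\<^sub>0\<parallel>]\<close> at time \<open>\<sigma>\<close>, the range in which
the bound is assumed. There the Lipschitz constant depends on the time horizon alone, so the iteration
converges on every bounded time interval and the solution is global.\<close>

lemma global_solution_below_linear_flow:
  fixes F :: "real \<Rightarrow> real \<Rightarrow> real"
  assumes F: "continuous_on ({0..} \<times> {0..}) (\<lambda>p. F (fst p) (snd p))"
      "\<And>\<sigma> s. 0 \<le> \<sigma> \<Longrightarrow> 0 \<le> s \<Longrightarrow> 0 \<le> F \<sigma> s"
    and lip: "\<And>R. \<exists>L>0. \<forall>\<sigma>\<in>{0..R}. \<forall>s\<in>{0..m}. \<forall>s'\<in>{0..m}. \<bar>F \<sigma> s - F \<sigma> s'\<bar> \<le> L * \<bar>s - s'\<bar>"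
    and v0: "\<And>x. 0 \<le> apply_bcontfun v0 x" "norm v0 \<le> m"
    and k: "\<And>t. 0 < t \<Longrightarrow> set_integrable lborel {0<..<t} k" "\<And>\<sigma>. 0 < \<sigma> \<Longrightarrow> 0 \<le> k \<sigma>"
      "\<And>t. 0 < t \<Longrightarrow> (LINT \<sigma>:{0<..<t}|lborel. k \<sigma>) \<le> 1 - \<delta>"
    and Fk: "\<And>\<sigma> s. 0 < \<sigma> \<Longrightarrow> 0 \<le> s \<Longrightarrow> s \<le> norm (semigroup_S \<Gamma> \<sigma> v0) \<Longrightarrow> F \<sigma> s \<le> k \<sigma> * s"
    and \<delta>: "0 \<le> \<delta>"
  obtains u where "continuous_on {0<..} u"
    "\<And>t x. 0 < t \<Longrightarrow> 0 \<le> apply_bcontfun (u t) x \<and> apply_bcontfun (u t) x \<le> m"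
    "\<And>t x. 0 < t \<Longrightarrow> apply_bcontfun (u t) x =
        semigroup_S \<Gamma> t (\<delta> *\<^sub>R v0) x + volume_potential \<Gamma> (\<lambda>\<sigma> y. F \<sigma> (apply_bcontfun (u \<sigma>) y)) t x"
proof -
  let ?\<phi> = "\<lambda>u \<sigma> y. F \<sigma> (apply_bcontfun (u \<sigma>) y)"
  define next_iterate where "next_iterate u t =
      semigroup_S \<Gamma> t (\<delta> *\<^sub>R v0) + Bcontfun (volume_potential \<Gamma> (?\<phi> u) t)" for u :: "real \<Rightarrow>
          ((real ^ 'n) \<Rightarrow>\<^sub>C real)" and t
  define admissible where "admissible u \<longleftrightarrow> continuous_on {0<..} u \<and>
     (\<forall>t>0. \<forall>x. 0 \<le> apply_bcontfun (u t) x \<and> apply_bcontfun (u t) x \<le> semigroup_S \<Gamma> t v0 x)"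
    for u :: "real \<Rightarrow> ((real ^ 'n) \<Rightarrow>\<^sub>C real)"
  have S_le: "semigroup_S \<Gamma> t v0 x \<le> norm (semigroup_S \<Gamma> t v0)" for t x
    using apply_bcontfun_abs_le[of "semigroup_S \<Gamma> t v0" x] by simp
  have S_le_m: "semigroup_S \<Gamma> t v0 x \<le> m" if "0 < t" for t x
    using S_le[of t x] semigroup_S_norm_le[OF that, of v0] v0(2) by linarith
  have S_nn: "0 \<le> semigroup_S \<Gamma> t v0 x" if "0 < t" for t x
    using kernel_op_nonneg[OF that v0(1)] by (simp add: semigroup_S_apply[OF that])
  have adm: "0 \<le> apply_bcontfun (u t) x" "apply_bcontfun (u t) x
      \<le> semigroup_S \<Gamma> t v0 x" "apply_bcontfun (u t) x \<le> m"
    if "admissible u" "0 < t" for u t x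
    using that S_le_m[OF that(2), of x] by (auto simp: admissible_def intro: order_trans)
  have adm_cont: "continuous_on {0<..} u" if "admissible u" for u using that by (simp add: admissible_def)
  have src: "\<exists>C. source_upto T C (?\<phi> u)" if u: "admissible u" for u T
    by (rule nonlinear_source[OF F(1) continuous_on_subset[OF adm_cont[OF u]], where m = m])
        (use adm[OF u] in auto)
  have slice: "continuous_on UNIV (?\<phi> u \<sigma>)" if u: "admissible u" and \<sigma>: "0 < \<sigma>" for u \<sigma>
  proof -
    have "continuous_on UNIV (\<lambda>y. (\<lambda>p. F (fst p) (snd p)) (\<sigma>, apply_bcontfun (u \<sigma>) y))"
      by (rule continuous_on_compose2[OF F(1)]) (use adm[OF u \<sigma>] \<sigma> in \<open>auto intro!: continuous_intros\<close>)
    then show ?thesis by simp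
  qed
  have next_apply: "apply_bcontfun (next_iterate u t) x
      = \<delta> * semigroup_S \<Gamma> t v0 x + volume_potential \<Gamma> (?\<phi> u) t x"
    if u: "admissible u" and t: "0 < t" for u t x
  proof -
    obtain C where "source_upto t C (?\<phi> u)" using src[OF u] by blast
    then have "volume_potential \<Gamma> (?\<phi> u) t \<in> bcontfun"
      by (rule volume_potential_bcontfun[OF _ t order_refl slice[OF u]])
    then show ?thesis using t by (simp add: next_iterate_def Bcontfun_inverse semigroup_S_scaleR)
  qed
  \<comment> \<open>The order interval is invariant: \<open>\<phi>(\<sigma>) \<le> k(\<sigma>) S(\<sigma>)v\<^sub>0\<close>, and \<open>S(t-\<sigma>)S(\<sigma>)v\<^sub>0 = S(t)v\<^sub>0\<close> does not depend on \<open>\<sigma>\<close>.\<close>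
  have next_adm: "admissible (next_iterate u)" if u: "admissible u" for u
    unfolding admissible_def
  proof (intro conjI allI impI)
    have "continuous_on {0<..} (\<lambda>t. semigroup_S \<Gamma> t (\<delta> *\<^sub>R v0) + Bcontfun (volume_potential \<Gamma> (?\<phi> u) t))"
      by (intro continuous_on_add semigroup_continuous volume_potential_continuous[OF src[OF u] slice[OF u]])
    then show "continuous_on {0<..} (next_iterate u)" by (simp add: next_iterate_def[abs_def])
    fix t x assume t: "(0::real) < t"
    obtain C where C: "source_upto t C (?\<phi> u)" using src[OF u] by blast
    have nn: "0 \<le> volume_potential \<Gamma> (?\<phi> u) t x"
      by (rule volume_potential_nonneg) (use F(2) adm[OF u] in auto)
    then show "0 \<le> apply_bcontfun (next_iterate u t) x"
      using S_nn[OF t] \<delta> by (simp add: next_apply[OF u t])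
    have "volume_potential \<Gamma> (?\<phi> u) t x \<le> (LINT \<sigma>:{0<..<t}|lborel. k \<sigma> * semigroup_S \<Gamma> t v0 x)"
    proof (rule volume_potential_le[OF C order_refl])
      show "set_integrable lborel {0<..<t} (\<lambda>\<sigma>. k \<sigma> * semigroup_S \<Gamma> t v0 x)"
        using k(1)[OF t] by simp
      fix \<sigma> assume \<sigma>: "0 < \<sigma>" "\<sigma> < t"
      then have r: "0 < t - \<sigma>" by simp
      have "kernel_op \<Gamma> (t - \<sigma>) (?\<phi> u \<sigma>) x \<le> kernel_op \<Gamma> (t - \<sigma>) (\<lambda>y. k \<sigma> * semigroup_S \<Gamma> \<sigma> v0 y) x"
      proof (rule kernel_op_mono[OF r source_slice_measurable[OF C \<sigma>]])
        show "(\<lambda>y. k \<sigma> * semigroup_S \<Gamma> \<sigma> v0 y) \<in> borel_measurable borel"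
          using apply_bcontfun_borel[of "semigroup_S \<Gamma> \<sigma> v0"] by simp
        show "\<bar>?\<phi> u \<sigma> y\<bar> \<le> max C (k \<sigma> * norm (semigroup_S \<Gamma> \<sigma> v0))" for y
          using source_bound[OF C \<sigma>, of y] by simp
        show "\<bar>k \<sigma> * semigroup_S \<Gamma> \<sigma> v0 y\<bar> \<le> max C (k \<sigma> * norm (semigroup_S \<Gamma> \<sigma> v0))" for y
          using apply_bcontfun_abs_le[of "semigroup_S \<Gamma> \<sigma> v0" y] k(2)[OF \<sigma>(1)]
          by (simp add: abs_mult mult_left_mono le_max_iff_disj)
        show "?\<phi> u \<sigma> y \<le> k \<sigma> * semigroup_S \<Gamma> \<sigma> v0 y" for y
        proof -
          have "?\<phi> u \<sigma> y \<le> k \<sigma> * apply_bcontfun (u \<sigma>) y"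
            using adm(1,2)[OF u \<sigma>(1), of y] S_le[of \<sigma> y] by (intro Fk[OF \<sigma>(1)]) auto
          also have "\<dots> \<le> k \<sigma> * semigroup_S \<Gamma> \<sigma> v0 y"
            using adm(2)[OF u \<sigma>(1), of y] k(2)[OF \<sigma>(1)] by (intro mult_left_mono) auto
          finally show ?thesis .
        qed
      qed
      also have "\<dots> = k \<sigma> * kernel_op \<Gamma> (t - \<sigma>) (kernel_op \<Gamma> \<sigma> (apply_bcontfun v0)) x"
        unfolding kernel_op_cmult semigroup_S_apply[OF \<sigma>(1)] ..
      also have "kernel_op \<Gamma> (t - \<sigma>) (kernel_op \<Gamma> \<sigma> (apply_bcontfun v0)) x = semigroup_S \<Gamma> t v0 x"
        using kernel_op_kernel_op[OF r \<sigma>(1) apply_bcontfun_borel apply_bcontfun_abs_le, where x = x]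
        by (simp add: semigroup_S_apply[OF t])
      finally show "kernel_op \<Gamma> (t - \<sigma>) (?\<phi> u \<sigma>) x \<le> k \<sigma> * semigroup_S \<Gamma> t v0 x" .
    qed
    also have "\<dots> = (LINT \<sigma>:{0<..<t}|lborel. k \<sigma>) * semigroup_S \<Gamma> t v0 x" by simp
    also have "\<dots> \<le> (1 - \<delta>) * semigroup_S \<Gamma> t v0 x"
      using k(3)[OF t] S_nn[OF t] by (rule mult_right_mono)
    finally show "apply_bcontfun (next_iterate u t) x \<le> semigroup_S \<Gamma> t v0 x"
      unfolding next_apply[OF u t] by (simp add: algebra_simps)
  qed
  \<comment> \<open>A Lipschitz constant of \<open>F\<close> up to time \<open>R\<close>; it sets the growth rate of the exponential weight.\<close>
  define weight_rate where "weight_rate R = (SOME L. 0 < L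
      \<and> (\<forall>\<sigma>\<in>{0..R}. \<forall>s\<in>{0..m}. \<forall>s'\<in>{0..m}. \<bar>F \<sigma> s - F \<sigma> s'\<bar> \<le> L * \<bar>s - s'\<bar>))" for R
  have L: "0 < weight_rate R"
    "\<And>\<sigma> s s'. \<sigma> \<in> {0..R} \<Longrightarrow> s \<in> {0..m} \<Longrightarrow> s' \<in> {0..m} \<Longrightarrow> \<bar>F \<sigma> s - F \<sigma> s'\<bar> \<le> weight_rate R * \<bar>s - s'\<bar>" for R
    using someI_ex[OF lip[of R, unfolded Bex_def]] unfolding weight_rate_def by blast+
  have contraction: "norm (next_iterate u t - next_iterate w t) \<le> A / 2 * exp (2 * weight_rate R * t)"
    if u: "admissible u" and w: "admissible w" and t: "0 < t" "t \<le> R" and A: "0 \<le> A"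
      and le: "\<And>\<sigma>. 0 < \<sigma> \<Longrightarrow> \<sigma> < t \<Longrightarrow> norm (u \<sigma> - w \<sigma>) \<le> A * exp (2 * weight_rate R * \<sigma>)" for u w t A R
  proof (rule norm_bound)
    fix x
    obtain C1 C2 where C: "source_upto t C1 (?\<phi> u)" "source_upto t C2 (?\<phi> w)" using src u w by meson
    note e = set_integral_exp_le[OF L(1)[of R] less_imp_le[OF t(1)]]
    have "\<bar>volume_potential \<Gamma> (?\<phi> u) t x - volume_potential \<Gamma> (?\<phi> w) t x\<bar>
        \<le> (LINT \<sigma>:{0<..<t}|lborel. A * (weight_rate R * exp (2 * weight_rate R * \<sigma>)))"
    proof (rule volume_potential_diff_le[OF C order_refl])
      show "set_integrable lborel {0<..<t} (\<lambda>\<sigma>. A * (weight_rate R * exp (2 * weight_rate R * \<sigma>)))"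
        using e(2) by simp
      fix \<sigma> y assume \<sigma>: "0 < \<sigma>" "\<sigma> < t"
      have "\<bar>?\<phi> u \<sigma> y - ?\<phi> w \<sigma> y\<bar> \<le> weight_rate R * \<bar>apply_bcontfun (u \<sigma>) y - apply_bcontfun (w \<sigma>) y\<bar>"
        using \<sigma> t adm[OF u \<sigma>(1)] adm[OF w \<sigma>(1)] by (intro L(2)) auto
      also have "\<dots> \<le> weight_rate R * (A * exp (2 * weight_rate R * \<sigma>))"
        using apply_bcontfun_abs_le[of "u \<sigma> - w \<sigma>" y] le[OF \<sigma>] L(1)[of R] by (intro mult_left_mono) auto
      finally show "\<bar>?\<phi> u \<sigma> y - ?\<phi> w \<sigma> y\<bar> \<le> A * (weight_rate R * exp (2 * weight_rate R * \<sigma>))"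
        by (simp add: mult.left_commute)
    qed
    also have "\<dots> = A * (LINT \<sigma>:{0<..<t}|lborel. weight_rate R * exp (2 * weight_rate R * \<sigma>))" by simp
    also have "\<dots> \<le> A * (exp (2 * weight_rate R * t) / 2)" using e(1) A by (rule mult_left_mono)
    finally show "norm (apply_bcontfun (next_iterate u t - next_iterate w t) x)
        \<le> A / 2 * exp (2 * weight_rate R * t)"
      by (simp add: next_apply[OF u t(1)] next_apply[OF w t(1)])
  qed
  define U where "U n = (next_iterate ^^ n) (\<lambda>t. 0)" for n
  have U_Suc: "U (Suc n) = next_iterate (U n)" for n by (simp add: U_def)
  have U0: "U 0 t = 0" for t by (simp add: U_def)
  have U_adm: "admissible (U n)" for n
  proof (induction n)
    case 0
    show ?case using S_nn by (auto simp: admissible_def U_def)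
  qed (simp add: U_Suc next_adm)
  have m0: "0 \<le> m" using v0(2) norm_ge_zero[of v0] by linarith
  have step: "norm (U (Suc n) t - U n t) \<le> m / 2 ^ n * exp (2 * weight_rate R * t)" if "0 < t" "t
      \<le> R" for n t R
    using that
  proof (induction n arbitrary: t)
    case 0
    have "norm (U (Suc 0) t - U 0 t) \<le> m"
      by (rule norm_bound) (use adm[OF U_adm[of 1] 0(1)] in \<open>simp add: U0\<close>)
    also have "\<dots> \<le> m * exp (2 * weight_rate R * t)"
      using mult_left_mono[OF _ m0, of 1 "exp (2 * weight_rate R * t)"] L(1)[of R] 0 by simp
    finally show ?case by simp
  next
    case (Suc n)
    have "norm (next_iterate (U (Suc n)) t - next_iterate (U n) t)
        \<le> (m / 2 ^ n) / 2 * exp (2 * weight_rate R * t)"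
      by (rule contraction[OF U_adm U_adm Suc.prems]) (use m0 Suc in auto)
    then show ?case by (simp add: U_Suc[of "Suc n"] U_Suc[of n] field_simps)
  qed
  \<comment> \<open>The telescoping series of the iterates converges by the geometric bound \<open>step\<close>.\<close>
  define u where "u t = (\<Sum>n. U (Suc n) t - U n t)" for t
  have U_lim: "uniform_limit {0<..<R} U u sequentially" for R
  proof -
    have "uniform_limit {0<..<R} (\<lambda>n t. \<Sum>i<n. U (Suc i) t - U i t) (\<lambda>t. \<Sum>n. U
        (Suc n) t - U n t) sequentially"
    proof (rule Weierstrass_m_test)
      show "norm (U (Suc n) t - U n t)
          \<le> m * exp (2 * weight_rate R * R) * (1 / 2) ^ n" if t: "t \<in> {0<..<R}" for n t
      proof -
        have "m / 2 ^ n * exp (2 * weight_rate R * t) \<le> m / 2 ^ n * exp (2 * weight_rate R * R)"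
          using t m0 L(1)[of R] by (intro mult_left_mono) auto
        then show ?thesis using step[of t R n] t by (simp add: power_one_over field_simps)
      qed
      show "summable (\<lambda>n. m * exp (2 * weight_rate R * R) * (1 / 2) ^ n)"
        by (intro summable_mult summable_geometric) simp
    qed
    moreover have "(\<Sum>i<n. U (Suc i) t - U i t) = U n t" for n t
      using sum_lessThan_telescope[of "\<lambda>i. U i t" n] by (simp add: U0)
    ultimately show ?thesis by (simp add: u_def[abs_def])
  qed
  have U_ptw: "(\<lambda>n. U n t) \<longlonglongrightarrow> u t" if "0 < t" for t
    by (rule tendsto_uniform_limitI[OF U_lim[of "t + 1"]]) (use that in auto)
  have u_ptw: "(\<lambda>n. apply_bcontfun (U n t) x) \<longlonglongrightarrow> apply_bcontfun (u t) x" if "0 < t" for t x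
    by (rule tendsto_uniform_limitI[OF tendsto_bcontfun_uniform_limit[OF U_ptw[OF that]]]) simp
  have u_cont: "continuous_on {0<..} u"
  proof (rule continuous_at_imp_continuous_on, rule ballI)
    fix t :: real assume t: "t \<in> {0<..}"
    have "continuous_on {0<..<t+1} u"
      by (rule uniform_limit_theorem[OF always_eventually U_lim])
        (auto intro: continuous_on_subset[OF adm_cont[OF U_adm]])
    then show "isCont u t" using t by (simp add: continuous_on_eq_continuous_at)
  qed
  have u_adm: "admissible u"
    unfolding admissible_def
  proof (intro conjI allI impI u_cont)
    fix t x assume t: "(0::real) < t"
    show "0 \<le> apply_bcontfun (u t) x"
      by (rule LIMSEQ_le_const[OF u_ptw[OF t]]) (use adm(1)[OF U_adm t] in blast)
    show "apply_bcontfun (u t) x \<le> semigroup_S \<Gamma> t v0 x"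
      by (rule LIMSEQ_le_const2[OF u_ptw[OF t]]) (use adm(2)[OF U_adm t] in blast)
  qed
  have fixed_point: "u t = next_iterate u t" if t: "0 < t" for t
  proof -
    have "(\<lambda>n. next_iterate (U n) t) \<longlonglongrightarrow> next_iterate u t"
    proof (rule metric_LIMSEQ_I)
      fix e :: real assume e: "0 < e"
      define A where "A = e / exp (2 * weight_rate t * t)"
      have A: "0 < A" using e by (simp add: A_def)
      have "\<forall>\<^sub>F n in sequentially. \<forall>\<sigma>\<in>{0<..<t}. dist (U n \<sigma>) (u \<sigma>) < A"
        by (rule uniform_limitD[OF U_lim A])
      then obtain n0 where n0: "\<And>n \<sigma>. n0 \<le> n \<Longrightarrow> 0 < \<sigma> \<Longrightarrow> \<sigma> < t \<Longrightarrow> norm (U n \<sigma> - u \<sigma>) < A"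
        unfolding eventually_sequentially dist_norm by fastforce
      show "\<exists>n0. \<forall>n\<ge>n0. dist (next_iterate (U n) t) (next_iterate u t) < e"
      proof (intro exI[of _ n0] allI impI)
        fix n assume n: "n0 \<le> n"
        have "norm (next_iterate (U n) t - next_iterate u t) \<le> A / 2 * exp (2 * weight_rate t * t)"
        proof (rule contraction[OF U_adm u_adm t order_refl less_imp_le[OF A]])
          fix \<sigma> assume \<sigma>: "0 < \<sigma>" "\<sigma> < t"
          have "A * 1 \<le> A * exp (2 * weight_rate t * \<sigma>)"
            using A \<sigma> L(1)[of t] by (intro mult_left_mono) auto
          then show "norm (U n \<sigma> - u \<sigma>) \<le> A * exp (2 * weight_rate t * \<sigma>)"
            using n0[OF n \<sigma>] by simp
        qed
        then show "dist (next_iterate (U n) t) (next_iterate u t) < e"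
          using e by (simp add: A_def dist_norm)
      qed
    qed
    moreover have "(\<lambda>n. next_iterate (U n) t) \<longlonglongrightarrow> u t"
      using LIMSEQ_Suc[OF U_ptw[OF t]] by (simp add: U_Suc)
    ultimately show ?thesis by (rule LIMSEQ_unique[symmetric])
  qed
  show thesis
  proof (rule that[OF u_cont])
    fix t x assume t: "(0::real) < t"
    show "0 \<le> apply_bcontfun (u t) x \<and> apply_bcontfun (u t) x \<le> m" using adm[OF u_adm t] by simp
    show "apply_bcontfun (u t) x = semigroup_S \<Gamma> t (\<delta> *\<^sub>R v0) x + volume_potential \<Gamma> (?\<phi> u) t x"
      using next_apply[OF u_adm t, of x] fixed_point[OF t] t by (simp add: semigroup_S_scaleR)
  qed
qed

end

lemma local_lipschitz_imp_lipschitz_on_Icc: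
  fixes f :: "real \<Rightarrow> real"
  assumes "local_lipschitz (UNIV :: real set) {0..} (\<lambda>_. f)"
  obtains L where "0 \<le> L" "\<And>s s'. s \<in> {0..m} \<Longrightarrow> s' \<in> {0..m} \<Longrightarrow> \<bar>f s - f s'\<bar> \<le> L * \<bar>s - s'\<bar>"
proof -
  have "local_lipschitz {0 :: real} {0..m} (\<lambda>_. f)"
    by (rule local_lipschitz_subset[OF assms]) auto
  from local_lipschitz_compact_implies_lipschitz[OF this compact_Icc compact_sing]
  obtain L where "L-lipschitz_on {0..m} f" by auto
  then show thesis
    by (intro that[of L]) (auto simp: lipschitz_on_def dist_real_def)
qed

context markov_kernel
begin

text \<open>Apply the preceding existence result to \<open>F(\<sigma>,s) = h(\<sigma>) f(s) + l(\<sigma>) g(s)\<close> and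
\<open>k(\<sigma>) = h(\<sigma>) f(n(\<sigma>))/n(\<sigma>) + l(\<sigma>) g(n(\<sigma>))/n(\<sigma>)\<close> with \<open>n(\<sigma>) = \<parallel>S(\<sigma>)v\<^sub>0\<parallel>\<close>. The value of the solution at \<open>t = 0\<close>
is prescribed separately, since the integral equation determines it for \<open>t > 0\<close> only.\<close>

lemma small_data_global_solution:
  assumes h: "continuous_on {0..} h" "\<And>t. 0 \<le> t \<Longrightarrow> 0 \<le> h t"
    and l: "continuous_on {0..} l" "\<And>t. 0 \<le> t \<Longrightarrow> 0 \<le> l t"
    and f: "local_lipschitz (UNIV :: real set) {0..} (\<lambda>_. f)" "\<And>s. 0 \<le> s \<Longrightarrow> 0 \<le> f s" "f 0 = 0"
    and g: "local_lipschitz (UNIV :: real set) {0..} (\<lambda>_. g)" "\<And>s. 0 \<le> s \<Longrightarrow> 0 \<le> g s" "g 0 = 0"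
    and mono: "mono_on {0<..m} (\<lambda>s. f s / s)" "mono_on {0<..m} (\<lambda>s. g s / s)"
    and v0: "v0 \<noteq> 0" "\<And>x. 0 \<le> apply_bcontfun v0 x" "norm v0 \<le> m"
    and small: "(\<integral>\<^sup>+\<sigma>\<in>{0..}. ennreal (h \<sigma> * (f (norm (semigroup_S \<Gamma> \<sigma> v0)) / norm
        (semigroup_S \<Gamma> \<sigma> v0))) \<partial>lborel)
        + (\<integral>\<^sup>+\<sigma>\<in>{0..}. ennreal (l \<sigma> * (g (norm (semigroup_S \<Gamma> \<sigma> v0)) / norm
            (semigroup_S \<Gamma> \<sigma> v0))) \<partial>lborel) < 1"
  shows "\<exists>\<delta>>0. \<exists>u. is_global_solution \<Gamma> h l f g (\<delta> *\<^sub>R v0) u"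
proof -
  define n where "n \<sigma> = norm (semigroup_S \<Gamma> \<sigma> v0)" for \<sigma>
  have n: "0 < n \<sigma>" "n \<sigma> \<le> m" if "0 < \<sigma>" for \<sigma>
  proof -
    have "0 < semigroup_S \<Gamma> \<sigma> v0 0" using kernel_op_pos[OF that v0(2,1)]
        by (simp add: semigroup_S_apply[OF that])
    then show "0 < n \<sigma>" by (auto simp: n_def)
    show "n \<sigma> \<le> m" using semigroup_S_norm_le[OF that, of v0] v0(3) by (simp add: n_def)
  qed
  have cf: "continuous_on {0..} f" and cg: "continuous_on {0..} g"
    using local_lipschitz_continuous_on[OF f(1)] local_lipschitz_continuous_on[OF g(1)] by auto
  define F where "F \<sigma> s = h \<sigma> * f s + l \<sigma> * g s" for \<sigma> s
  define k where "k \<sigma> = h \<sigma> * (f (n \<sigma>) / n \<sigma>) + l \<sigma> * (g (n \<sigma>) / n \<sigma>)" for \<sigma>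
  define I where "I = (\<integral>\<^sup>+\<sigma>\<in>{0..}. ennreal (h \<sigma> * (f (n \<sigma>) / n \<sigma>)) \<partial>lborel) + (\<integral>\<^sup>+\<sigma>\<in>{0..}. ennreal (l \<sigma> *
      (g (n \<sigma>) / n \<sigma>)) \<partial>lborel)"
  have I: "I < 1" using small by (simp add: I_def n_def)
  define \<delta> where "\<delta> = 1 - enn2real I"
  have \<delta>: "0 < \<delta>"
    using I by (cases I rule: ennreal_cases) (auto simp: \<delta>_def)
  have k0: "0 \<le> k \<sigma>" if "0 < \<sigma>" for \<sigma>
    using n[OF that] h(2)[of \<sigma>] l(2)[of \<sigma>] f(2)[of "n \<sigma>"] g(2)[of "n \<sigma>"] that by (auto simp: k_def)
  have n_cont: "continuous_on {0<..} n"
    unfolding n_def by (intro continuous_on_norm semigroup_continuous)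
  have q_cont: "continuous_on {0<..} (\<lambda>\<sigma>. p \<sigma> * (q (n \<sigma>) / n \<sigma>))"
    if "continuous_on {0..} p" "continuous_on {0..} q" for p q :: "real \<Rightarrow> real"
    by (intro continuous_on_mult continuous_on_divide continuous_on_subset[OF that(1)]
        continuous_on_compose2[OF that(2) n_cont] n_cont)
            (use n in \<open>auto intro: less_imp_le simp: less_imp_neq[symmetric]\<close>)
  have k_cont: "continuous_on {0<..} k"
    unfolding k_def by (intro continuous_on_add q_cont h l cf cg)
  have kI: "(\<integral>\<^sup>+\<sigma>. ennreal (indicator {0<..<t} \<sigma> * k \<sigma>) \<partial>lborel) \<le> I" for t
  proof -
    have meas: "(\<lambda>\<sigma>. ennreal (indicator {0<..<t} \<sigma> * (p \<sigma> * (q (n \<sigma>) / n \<sigma>)))) \<in> borel_measurable lborel"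
      if "continuous_on {0..} p" "continuous_on {0..} q" for p q :: "real \<Rightarrow> real"
    proof -
      have "continuous_on {0<..<t} (\<lambda>\<sigma>. p \<sigma> * (q (n \<sigma>) / n \<sigma>))"
        by (rule continuous_on_subset[OF q_cont[OF that]]) auto
      from borel_measurable_continuous_on_indicator[OF _ this] show ?thesis by simp
    qed
    have "(\<integral>\<^sup>+\<sigma>. ennreal (indicator {0<..<t} \<sigma> * k \<sigma>) \<partial>lborel) =
        (\<integral>\<^sup>+\<sigma>. ennreal (indicator {0<..<t} \<sigma> * (h \<sigma> * (f (n \<sigma>) / n \<sigma>))) + ennreal (indicator {0<..<t} \<sigma> *
            (l \<sigma> * (g (n \<sigma>) / n \<sigma>))) \<partial>lborel)"
      using n h(2) l(2) f(2) g(2)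
      by (intro nn_integral_cong)
          (auto simp: indicator_def k_def less_imp_le intro!: ennreal_plus mult_nonneg_nonneg divide_nonneg_nonneg)
    also have "\<dots> = (\<integral>\<^sup>+\<sigma>. ennreal (indicator {0<..<t} \<sigma> * (h \<sigma> * (f (n \<sigma>) / n \<sigma>))) \<partial>lborel)
       + (\<integral>\<^sup>+\<sigma>. ennreal (indicator {0<..<t} \<sigma> * (l \<sigma> * (g (n \<sigma>) / n \<sigma>))) \<partial>lborel)"
      by (rule nn_integral_add[OF meas[OF h(1) cf] meas[OF l(1) cg]])
    also have "\<dots> \<le> I"
      unfolding I_def by (intro add_mono nn_integral_mono) (auto simp: indicator_def)
    finally show ?thesis .
  qed
  have k_int: "integrable lborel (\<lambda>\<sigma>. indicator {0<..<t} \<sigma> * k \<sigma>)" for t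
  proof (rule integrableI_nonneg)
    show "(\<lambda>\<sigma>. indicator {0<..<t} \<sigma> * k \<sigma>) \<in> borel_measurable lborel"
    proof -
      have "continuous_on {0<..<t} k" by (rule continuous_on_subset[OF k_cont]) auto
      from borel_measurable_continuous_on_indicator[OF _ this] show ?thesis by simp
    qed
    show "(\<integral>\<^sup>+\<sigma>. ennreal (indicator {0<..<t} \<sigma> * k \<sigma>) \<partial>lborel) < \<infinity>"
      using kI[of t] I by (metis ennreal_one_less_top infinity_ennreal_def le_less_trans less_trans)
  qed (use k0 in \<open>auto simp: indicator_def\<close>)
  have k_le: "(LINT \<sigma>:{0<..<t}|lborel. k \<sigma>) \<le> 1 - \<delta>" for t
  proof -
    have "(LINT \<sigma>:{0<..<t}|lborel. k \<sigma>) = enn2real (\<integral>\<^sup>+\<sigma>. ennreal (indicator {0<..<t} \<sigma> * k \<sigma>) \<partial>lborel)"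
      unfolding set_lebesgue_integral_def real_scaleR_def
      by (rule integral_eq_nn_integral) (use k_int[of t] k0 in \<open>auto simp: indicator_def\<close>)
    also have "\<dots> \<le> enn2real I"
      by (rule enn2real_mono[OF kI]) (use I in \<open>auto intro: less_trans\<close>)
    finally show ?thesis by (simp add: \<delta>_def)
  qed
  have quot: "q s \<le> q N / N * s"
    if "mono_on {0<..m} (\<lambda>s. q s / s)" "q 0 = 0" "0 \<le> s" "s \<le> N" "0 < N" "N
        \<le> m" for q :: "real \<Rightarrow> real" and s N
  proof (cases "s = 0")
    case False
    then have "q s / s \<le> q N / N" using that by (intro mono_onD[OF that(1)]) auto
    then show ?thesis using False that(3) by (simp add: pos_divide_le_eq)
  qed (use that in simp)
  obtain Lf where Lf: "0 \<le> Lf" "\<And>s s'. s \<in> {0..m} \<Longrightarrow> s' \<in> {0..m} \<Longrightarrow> \<bar>f s - f s'\<bar> \<le> Lf * \<bar>s - s'\<bar>"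
    using local_lipschitz_imp_lipschitz_on_Icc[OF f(1)] by metis
  obtain Lg where Lg: "0 \<le> Lg" "\<And>s s'. s \<in> {0..m} \<Longrightarrow> s' \<in> {0..m} \<Longrightarrow> \<bar>g s - g s'\<bar> \<le> Lg * \<bar>s - s'\<bar>"
    using local_lipschitz_imp_lipschitz_on_Icc[OF g(1)] by metis
  have bd: "\<exists>A\<ge>0. \<forall>s\<in>{0..R}. p s \<le> A" if "continuous_on {0..} p" for p :: "real \<Rightarrow> real" and R
  proof -
    have "bounded (p ` {0..R})"
      by (intro compact_imp_bounded compact_continuous_image continuous_on_subset[OF that]) auto
    then obtain A where "\<forall>s\<in>{0..R}. \<bar>p s\<bar> \<le> A" by (auto simp: bounded_iff)
    then show ?thesis by (intro exI[of _ "\<bar>A\<bar>"]) force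
  qed
  have F_cont: "continuous_on ({0..} \<times> {0..}) (\<lambda>p. p1 (fst p) * q (snd p))"
    if "continuous_on {0..} p1" "continuous_on {0..} q" for p1 q :: "real \<Rightarrow> real"
    by (intro continuous_on_mult continuous_on_compose2[OF that(1)] continuous_on_compose2[OF that(2)] continuous_intros) auto
  obtain u where u: "continuous_on {0<..} u"
    "\<And>t x. 0 < t \<Longrightarrow> 0 \<le> apply_bcontfun (u t) x \<and> apply_bcontfun (u t) x \<le> m"
    "\<And>t x. 0 < t \<Longrightarrow> apply_bcontfun (u t) x =
        semigroup_S \<Gamma> t (\<delta> *\<^sub>R v0) x + volume_potential \<Gamma> (\<lambda>\<sigma> y. F \<sigma> (apply_bcontfun (u \<sigma>) y)) t x"
  proof (rule global_solution_below_linear_flow[where F = F and m = m and ?v0.0 = v0 and k = k and \<delta> = \<delta>])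
    show "continuous_on ({0..} \<times> {0..}) (\<lambda>p. F (fst p) (snd p))"
      unfolding F_def by (intro continuous_on_add F_cont h l cf cg)
    show "0 \<le> F \<sigma> s" if "0 \<le> \<sigma>" "0 \<le> s" for \<sigma> s
      using that h(2) l(2) f(2) g(2) by (simp add: F_def)
    show "\<exists>L>0. \<forall>\<sigma>\<in>{0..R}. \<forall>s\<in>{0..m}. \<forall>s'\<in>{0..m}. \<bar>F \<sigma> s - F \<sigma> s'\<bar> \<le> L * \<bar>s - s'\<bar>" for R
    proof -
      obtain A B where A: "0 \<le> A" "\<forall>s\<in>{0..R}. h s \<le> A" and B: "0 \<le> B" "\<forall>s\<in>{0..R}. l s \<le> B"
        using bd[OF h(1), of R] bd[OF l(1), of R] by blast
      show ?thesis
      proof (intro exI[of _ "A * Lf + B * Lg + 1"] conjI ballI)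
        show "0 < A * Lf + B * Lg + 1" using A B Lf(1) Lg(1) by (simp add: add_nonneg_pos)
        fix \<sigma> s s' assume \<sigma>: "\<sigma> \<in> {0..R}" and s: "s \<in> {0..m}" "s' \<in> {0..m}"
        have "F \<sigma> s - F \<sigma> s' = h \<sigma> * (f s - f s') + l \<sigma> * (g s - g s')" by (simp add: F_def algebra_simps)
        also have "\<bar>\<dots>\<bar> \<le> \<bar>h \<sigma>\<bar> * \<bar>f s - f s'\<bar> + \<bar>l \<sigma>\<bar> * \<bar>g s - g s'\<bar>"
          by (rule order_trans[OF abs_triangle_ineq]) (simp add: abs_mult)
        also have "\<dots> \<le> A * (Lf * \<bar>s - s'\<bar>) + B * (Lg * \<bar>s - s'\<bar>)"
          using \<sigma> A B h(2)[of \<sigma>] l(2)[of \<sigma>] Lf(2)[OF s] Lg(2)[OF s] by (intro add_mono mult_mono) auto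
        also have "\<dots> \<le> (A * Lf + B * Lg + 1) * \<bar>s - s'\<bar>" by (simp add: algebra_simps)
        finally show "\<bar>F \<sigma> s - F \<sigma> s'\<bar> \<le> (A * Lf + B * Lg + 1) * \<bar>s - s'\<bar>" .
      qed
    qed
    show "set_integrable lborel {0<..<t} k" for t using k_int[of t] by (simp add: set_integrable_def)
    show "F \<sigma> s \<le> k \<sigma> * s" if \<sigma>: "0 < \<sigma>" and s: "0 \<le> s" "s \<le> norm (semigroup_S \<Gamma> \<sigma> v0)" for \<sigma> s
    proof -
      have "s \<le> n \<sigma>" using s(2) by (simp add: n_def)
      then have "f s \<le> f (n \<sigma>) / n \<sigma> * s" "g s \<le> g (n \<sigma>) / n \<sigma> * s"
        using quot[OF mono(1) f(3) s(1) _ n[OF \<sigma>]] quot[OF mono(2) g(3) s(1) _ n[OF \<sigma>]] by auto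
      then have "h \<sigma> * f s + l \<sigma> * g s \<le> h \<sigma> * (f (n \<sigma>) / n \<sigma> * s) + l \<sigma> * (g (n \<sigma>) / n \<sigma> * s)"
        using h(2)[of \<sigma>] l(2)[of \<sigma>] \<sigma> by (intro add_mono mult_left_mono) auto
      then show ?thesis by (simp add: F_def k_def algebra_simps)
    qed
    show "0 \<le> \<delta>" using \<delta> by simp
    show "0 \<le> apply_bcontfun v0 x" for x by (rule v0(2))
    show "norm v0 \<le> m" by (rule v0(3))
    show "0 \<le> k \<sigma>" if "0 < \<sigma>" for \<sigma> using that by (rule k0)
    show "(LINT \<sigma>:{0<..<t}|lborel. k \<sigma>) \<le> 1 - \<delta>" for t by (rule k_le)
  qed (rule that)
  define w where "w t = (if t = 0 then \<delta> *\<^sub>R v0 else u t)" for t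
  have w: "w t = u t" if "0 < t" for t using that by (simp add: w_def)
  have src: "\<exists>C. source_upto T C (\<lambda>\<sigma> y. p \<sigma> * q (apply_bcontfun (u \<sigma>) y))"
    if "continuous_on {0..} p" "continuous_on {0..} q" for p q and T :: real
    by (rule nonlinear_source[where F
        = "\<lambda>\<sigma> s. p \<sigma> * q s", OF F_cont[OF that] continuous_on_subset[OF u(1)]])
      (use u(2) in auto)
  have duh: "duhamel \<Gamma> p q w t x
      = volume_potential \<Gamma> (\<lambda>\<sigma> y. p \<sigma> * q (apply_bcontfun (u \<sigma>) y)) t x" for p q t x
    unfolding duhamel_def volume_potential_def
    by (rule set_lebesgue_integral_cong) (auto simp: w)
  have eq: "apply_bcontfun (w t) x
      = semigroup_S \<Gamma> t (\<delta> *\<^sub>R v0) x + duhamel \<Gamma> h f w t x + duhamel \<Gamma> l g w t x"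
    if t: "0 < t" for t x
  proof -
    obtain C1 C2 where C: "source_upto t C1 (\<lambda>\<sigma> y. h \<sigma> * f (apply_bcontfun (u \<sigma>) y))"
      "source_upto t C2 (\<lambda>\<sigma> y. l \<sigma> * g (apply_bcontfun (u \<sigma>) y))"
      using src[OF h(1) cf] src[OF l(1) cg] by meson
    show ?thesis
      using u(3)[OF t, of x] volume_potential_add[OF C order_refl, of x] by (simp add: w[OF t] duh F_def)
  qed
  have lim: "((\<lambda>t. norm (w t - semigroup_S \<Gamma> t (\<delta> *\<^sub>R v0))) \<longlongrightarrow> 0) (at_right 0)"
  proof -
    obtain C1 C2 where C: "source_upto 1 C1 (\<lambda>\<sigma> y. h \<sigma> * f (apply_bcontfun (u \<sigma>) y))"
      "source_upto 1 C2 (\<lambda>\<sigma> y. l \<sigma> * g (apply_bcontfun (u \<sigma>) y))"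
      using src[OF h(1) cf] src[OF l(1) cg] by meson
    have "norm (w t - semigroup_S \<Gamma> t (\<delta> *\<^sub>R v0)) \<le> C1 * t + C2 * t" if t: "0 < t" "t < 1" for t
    proof (rule norm_bound)
      fix x
      have "(w t - semigroup_S \<Gamma> t (\<delta> *\<^sub>R v0)) x = duhamel \<Gamma> h f w t x + duhamel \<Gamma> l g w t x"
        using eq[OF t(1), of x] by simp
      then show "norm ((w t - semigroup_S \<Gamma> t (\<delta> *\<^sub>R v0)) x) \<le> C1 * t + C2 * t"
        using volume_potential_abs_le[OF C(1) t(1), of x] volume_potential_abs_le[OF C(2) t(1), of x] t
            by (simp add: duh)
    qed
    then have "\<forall>\<^sub>F t in at_right 0. norm (w t - semigroup_S \<Gamma> t (\<delta> *\<^sub>R v0)) \<le> C1 * t + C2 * t"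
      unfolding eventually_at_right_field by (intro exI[of _ 1]) auto
    moreover have "((\<lambda>t. C1 * t + C2 * t) \<longlongrightarrow> 0) (at_right 0)" by (auto intro!: tendsto_eq_intros)
    ultimately show ?thesis
      by (rule tendsto_sandwich[OF always_eventually _ tendsto_const, rotated]) simp
  qed
  have w_cont: "continuous_on {0<..} w"
    using u(1) by (rule continuous_on_eq) (simp add: w)
  have w_nn: "0 \<le> apply_bcontfun (w t) x" if "0 \<le> t" for t x
    using u(2)[of t x] v0(2)[of x] \<delta> that by (auto simp: w_def)
  have "is_global_solution \<Gamma> h l f g (\<delta> *\<^sub>R v0) w"
    unfolding is_global_solution_def is_solution_def integral_equation_def
    using eq lim w_cont w_nn by (simp add: w_def[of 0] greaterThan_def)
  with \<delta> show ?thesis by blast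
qed

end

section \<open>Blow-up of large solutions\<close>

text \<open>Let \<open>\<Psi>(s) = z + \<integral>\<^sub>0\<^sup>s h f(\<psi>)\<close>. Then \<open>\<Psi> \<le> \<psi>\<close>, so \<open>\<Psi>' = h f(\<psi>) \<ge> h f(\<Psi>)\<close> by monotonicity of \<open>f\<close>, and the
primitive \<open>G\<close> of \<open>1/f\<close> satisfies \<open>(G \<circ> \<Psi>)' \<ge> h\<close>. Integrate from \<open>0\<close> to \<open>t\<close>.\<close>

lemma osgood_comparison:
  fixes h f \<psi> :: "real \<Rightarrow> real"
  assumes h: "continuous_on {0..t} h" "\<And>s. s \<in> {0..t} \<Longrightarrow> 0 \<le> h s"
    and f: "continuous_on {0..} f" "mono_on {0..} f" "0 \<le> f 0" "\<And>s. 0 < s \<Longrightarrow> 0 < f s"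
    and \<psi>: "continuous_on {0..t} \<psi>" "\<And>s. s \<in> {0..t} \<Longrightarrow> 0 \<le> \<psi> s \<and> \<psi> s \<le> M"
      "\<And>s. s \<in> {0..t} \<Longrightarrow> z + integral {0..s} (\<lambda>\<sigma>. h \<sigma> * f (\<psi> \<sigma>)) \<le> \<psi> s"
    and z: "0 < z" and t: "0 \<le> t"
  shows "integral {0..t} h \<le> integral {z..M} (\<lambda>s. 1 / f s)"
proof -
  define \<Psi> where "\<Psi> s = z + integral {0..s} (\<lambda>\<sigma>. h \<sigma> * f (\<psi> \<sigma>))" for s
  \<comment> \<open>The lower limit \<open>z/2\<close> makes \<open>z\<close> an interior point, where \<open>G\<close> has a two-sided derivative.\<close>
  define G where "G w = integral {z/2..w} (\<lambda>s. 1 / f s)" for w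
  define H where "H s = integral {0..s} h" for s
  have cf: "continuous_on {z/2..b} (\<lambda>s. 1 / f s)" for b
  proof (rule continuous_on_divide[OF continuous_on_const])
    show "continuous_on {z/2..b} f" by (rule continuous_on_subset[OF f(1)]) (use z in auto)
    show "\<forall>s\<in>{z/2..b}. f s \<noteq> 0"
    proof
      fix s assume "s \<in> {z/2..b}"
      then show "f s \<noteq> 0" using f(4)[of s] z by auto
    qed
  qed
  have f0: "0 \<le> f s" if "0 \<le> s" for s using f(3) f(4)[of s] that by (cases "s
      = 0") (auto intro: less_imp_le)
  have ch: "continuous_on {0..t} (\<lambda>\<sigma>. h \<sigma> * f (\<psi> \<sigma>))"
    by (intro continuous_on_mult h continuous_on_compose2[OF f(1) \<psi>(1)]) (use \<psi> in auto)
  have \<Psi>: "z \<le> \<Psi> s" "\<Psi> s \<le> \<psi> s" "\<Psi> s \<le> M" if s: "s \<in> {0..t}" for s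
  proof -
    have "0 \<le> integral {0..s} (\<lambda>\<sigma>. h \<sigma> * f (\<psi> \<sigma>))"
    proof (rule Henstock_Kurzweil_Integration.integral_nonneg[OF integrable_continuous_real])
      show "continuous_on {0..s} (\<lambda>\<sigma>. h \<sigma> * f (\<psi> \<sigma>))" by (rule continuous_on_subset[OF ch]) (use s in auto)
      show "0 \<le> h \<sigma> * f (\<psi> \<sigma>)" if "\<sigma> \<in> {0..s}" for \<sigma>
        using h(2)[of \<sigma>] f0[of "\<psi> \<sigma>"] \<psi>(2)[of \<sigma>] s that by simp
    qed
    then show "z \<le> \<Psi> s" by (simp add: \<Psi>_def)
    show "\<Psi> s \<le> \<psi> s" using \<psi>(3)[OF s] by (simp add: \<Psi>_def)
    then show "\<Psi> s \<le> M" using \<psi>(2)[OF s] by simp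
  qed
  have dG: "(G has_real_derivative 1 / f w) (at w)" if "z \<le> w" for w
  proof -
    have "(G has_real_derivative 1 / f w) (at w within {z/2..w+1})"
      unfolding G_def by (rule integral_has_real_derivative[OF cf]) (use that z in auto)
    then show ?thesis using at_within_Icc_at[of "z/2" w "w+1"] that z by simp
  qed
  have d\<Psi>: "(\<Psi> has_real_derivative h s * f (\<psi> s)) (at s within {0..t})" if s: "s \<in> {0..t}" for s
    unfolding \<Psi>_def
    using DERIV_add[OF DERIV_const[of z] integral_has_real_derivative[OF ch s]] by simp
  have dH: "(H has_real_derivative h s) (at s within {0..t})" if s: "s \<in> {0..t}" for s
    unfolding H_def by (rule integral_has_real_derivative[OF h(1) s])
  have dD: "((\<lambda>s. G (\<Psi> s) - H s) has_real_derivative 1 / f (\<Psi> s) * (h s * f (\<psi> s)) - h s)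
      (at s within {0..t})"
    if s: "s \<in> {0..t}" for s
    by (rule DERIV_diff[OF DERIV_chain2[OF dG[OF \<Psi>(1)[OF s]] d\<Psi>[OF s]] dH[OF s]])
  have "G (\<Psi> 0) - H 0 \<le> G (\<Psi> t) - H t"
  proof (rule DERIV_nonneg_imp_increasing_open[OF t])
    show "continuous_on {0..t} (\<lambda>s. G (\<Psi> s) - H s)"
      by (rule DERIV_continuous_on[OF dD])
    fix s assume s: "0 < s" "s < t"
    then have s': "s \<in> {0..t}" by auto
    have "f (\<Psi> s) \<le> f (\<psi> s)" "0 < f (\<Psi> s)"
      using \<Psi>[OF s'] z f(4)[of "\<Psi> s"] by (auto intro!: mono_onD[OF f(2)])
    then have "1 \<le> f (\<psi> s) / f (\<Psi> s)" by simp
    from mult_left_mono[OF this h(2)[OF s']]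
    have "0 \<le> 1 / f (\<Psi> s) * (h s * f (\<psi> s)) - h s" by simp
    then show "\<exists>y. ((\<lambda>s. G (\<Psi> s) - H s) has_real_derivative y) (at s) \<and> 0 \<le> y"
      using dD[OF s'] at_within_Icc_at[OF s] by auto
  qed
  then have "H t \<le> G (\<Psi> t) - G z" by (simp add: \<Psi>_def H_def)
  also have "G (\<Psi> t) - G z = integral {z..\<Psi> t} (\<lambda>s. 1 / f s)"
    using Henstock_Kurzweil_Integration.integral_combine[OF _ _ integrable_continuous_real[OF cf], of z "\<Psi> t"] \<Psi>[of t] t z by (simp add: G_def)
  also have "\<dots> \<le> integral {z..M} (\<lambda>s. 1 / f s)"
  proof (rule integral_subset_le)
    have "(\<lambda>s. 1 / f s) integrable_on {z..b}" for b
      by (rule integrable_continuous_real, rule continuous_on_subset[OF cf[of b]]) (use z in auto)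
    then show "(\<lambda>s. 1 / f s) integrable_on {z..\<Psi> t}" "(\<lambda>s. 1 / f s) integrable_on {z..M}" by auto
    show "{z..\<Psi> t} \<subseteq> {z..M}" using \<Psi>[of t] t by auto
    show "\<forall>s\<in>{z..M}. 0 \<le> 1 / f s" using f0 z by auto
  qed
  finally show ?thesis by (simp add: H_def)
qed

lemma nn_integral_Icc_continuous:
  fixes k :: "real \<Rightarrow> real"
  assumes k: "continuous_on {a..b} k" "\<And>s. s \<in> {a..b} \<Longrightarrow> 0 \<le> k s"
  shows "(\<integral>\<^sup>+s\<in>{a..b}. ennreal (k s) \<partial>lborel) = ennreal (integral {a..b} k)"
proof -
  have i: "set_integrable lborel {a..b} k" by (rule borel_integrable_atLeastAtMost'[OF k(1)])
  have "(\<integral>\<^sup>+s\<in>{a..b}. ennreal (k s) \<partial>lborel) = (\<integral>\<^sup>+s. ennreal (indicator {a..b} s *\<^sub>R k s) \<partial>lborel)"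
    by (intro nn_integral_cong) (auto simp: indicator_def)
  also have "\<dots> = ennreal (LINT s:{a..b}|lborel. k s)"
    unfolding set_lebesgue_integral_def
    by (rule nn_integral_eq_integral) (use i k(2) in \<open>auto simp: set_integrable_def indicator_def\<close>)
  also have "(LINT s:{a..b}|lborel. k s) = integral {a..b} k"
    by (rule set_borel_integral_eq_integral(2)[OF i])
  finally show ?thesis .
qed

text \<open>A curve that is continuous for \<open>t > 0\<close> need not be bounded near \<open>0\<close>; here it stays close to a bounded
one.\<close>

lemma bounded_on_initial_interval:
  fixes u :: "real \<Rightarrow> ((real ^ 'n::finite) \<Rightarrow>\<^sub>C real)"
  assumes c: "continuous_on {0<..} u" and lim: "((\<lambda>t. norm (u t - w t)) \<longlongrightarrow> 0) (at_right 0)"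
    and w: "\<And>t. 0 < t \<Longrightarrow> norm (w t) \<le> B"
  obtains M where "\<And>t y. 0 < t \<Longrightarrow> t \<le> T \<Longrightarrow> \<bar>apply_bcontfun (u t) y\<bar> \<le> M"
proof -
  have "\<forall>\<^sub>F t in at_right 0. norm (u t - w t) < 1" using order_tendstoD(2)[OF lim, of 1] by simp
  then obtain r where r: "0 < r" "\<And>t. 0 < t \<Longrightarrow> t < r \<Longrightarrow> norm (u t - w t) < 1"
    by (auto simp: eventually_at_right_field)
  have "bounded (u ` {r/2..T})"
    by (intro compact_imp_bounded compact_continuous_image continuous_on_subset[OF c]) (use r in auto)
  then obtain M1 where M1: "\<forall>t\<in>{r/2..T}. norm (u t) \<le> M1" by (auto simp: bounded_iff)
  have "\<bar>apply_bcontfun (u t) y\<bar> \<le> max 1 (max M1 (B + 1))" if t: "0 < t" "t \<le> T" for t y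
  proof -
    have "norm (u t) \<le> max M1 (B + 1)"
    proof (cases "t < r")
      case True
      then have "norm (u t) \<le> B + 1"
        using r(2)[of t] w[of t] t norm_triangle_sub[of "u t" "w t"] by linarith
      then show ?thesis by simp
    next
      case False
      then have "norm (u t) \<le> M1" using M1 t r by auto
      then show ?thesis by simp
    qed
    then show ?thesis using norm_bounded[of "u t" y] by simp
  qed
  then show thesis by (intro that[of "max 1 (max M1 (B + 1))"]) auto
qed

context markov_kernel
begin

text \<open>The function \<open>\<psi>(t) = (S(\<tau>-t)u(t))(x)\<close> satisfies the integral inequality of \<open>osgood_comparison\<close> on each
\<open>[0,t]\<close> with \<open>t < \<tau>\<close>; at \<open>t = \<tau>\<close> the kernel degenerates, so the conclusion is reached there by letting
\<open>t \<rightarrow> \<tau>\<close>.\<close>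

lemma supersolution_integral_bound:
  assumes h: "continuous_on {0..} h" "\<And>t. 0 \<le> t \<Longrightarrow> 0 \<le> h t"
    and f: "continuous_on {0..} f" "f \<in> Phi_class \<Gamma>"
    and u0: "\<And>x. 0 \<le> apply_bcontfun u0 x"
    and u: "continuous_on {0<..} u" "\<And>t x. 0 < t \<Longrightarrow> 0 \<le> apply_bcontfun (u t) x"
      "((\<lambda>t. norm (u t - semigroup_S \<Gamma> t u0)) \<longlongrightarrow> 0) (at_right 0)"
    and super: "\<And>t x. 0 < t \<Longrightarrow>
      semigroup_S \<Gamma> t u0 x + volume_potential \<Gamma> (\<lambda>\<sigma> y. h \<sigma> * f (apply_bcontfun (u \<sigma>) y)) t x
          \<le> apply_bcontfun (u t) x"
    and M: "\<And>t y. 0 < t \<Longrightarrow> t \<le> \<tau> \<Longrightarrow> apply_bcontfun (u t) y \<le> M" "norm u0 \<le> M"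
    and \<tau>: "0 < \<tau>" and z: "z = semigroup_S \<Gamma> \<tau> u0 x" "0 < z"
  shows "integral {0..\<tau>} h \<le> integral {z..M} (\<lambda>s. 1 / f s)"
proof -
  have Phi: "mono_on {0..} f" "\<And>s. 0 < s \<Longrightarrow> 0 < f s" "\<And>s. 0 \<le> s \<Longrightarrow> 0 \<le> f s"
    and jensen: "\<And>v t x. (\<And>y. 0 \<le> apply_bcontfun v y) \<Longrightarrow> 0 < t \<Longrightarrow>
        f (semigroup_S \<Gamma> t v x) \<le> kernel_op \<Gamma> t (\<lambda>y. f (apply_bcontfun v y)) x"
    using f(2) unfolding Phi_class_def by blast+
  let ?\<phi> = "\<lambda>\<sigma> y. h \<sigma> * f (apply_bcontfun (u \<sigma>) y)"
  have "continuous_on ({0..} \<times> {0..}) (\<lambda>p. h (fst p) * f (snd p))"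
    by (intro continuous_on_mult continuous_on_compose2[OF h(1)] continuous_on_compose2[OF f(1)] continuous_intros) auto
  then have "\<exists>C. source_upto \<tau> C ?\<phi>"
    by (rule nonlinear_source[where F = "\<lambda>\<sigma> s. h \<sigma> * f s" and m = M])
      (use u M in \<open>auto intro: continuous_on_subset\<close>)
  then obtain C where C: "source_upto \<tau> C ?\<phi>" by blast
  \<comment> \<open>At \<open>\<sigma> = 0\<close> the function is given its limit \<open>z\<close>, which it has because \<open>u(\<sigma>) - S(\<sigma>)u\<^sub>0 \<rightarrow> 0\<close>.\<close>
  define \<psi> where "\<psi> \<sigma> = (if \<sigma> = 0 then z else kernel_op \<Gamma> (\<tau> - \<sigma>) (apply_bcontfun (u \<sigma>)) x)" for \<sigma>
  have z': "z = kernel_op \<Gamma> \<tau> (apply_bcontfun u0) x" using z(1) semigroup_S_apply[OF \<tau>] by simp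
  have \<psi>_cont: "continuous_on {0..<\<tau>} \<psi>"
    unfolding continuous_on_def
  proof
    fix s assume s: "s \<in> {0..<\<tau>}"
    show "(\<psi> \<longlongrightarrow> \<psi> s) (at s within {0..<\<tau>})"
    proof (cases "s = 0")
      case True
      have l1: "((\<lambda>t. u t - semigroup_S \<Gamma> t u0) \<longlongrightarrow> 0) (at_right 0)"
        using u(3) by (rule tendsto_norm_zero_cancel)
      have l2: "((\<lambda>t. \<tau> - t) \<longlongrightarrow> \<tau>) (at_right 0)" by (auto intro!: tendsto_eq_intros)
      have "((\<lambda>t. kernel_op \<Gamma> (\<tau> - t) (apply_bcontfun (u t - semigroup_S \<Gamma> t u0)) x + z)
          \<longlongrightarrow> kernel_op \<Gamma> \<tau> (apply_bcontfun 0) x + z) (at_right 0)"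
        by (intro tendsto_add tendsto_const kernel_op_tendsto[OF l1 l2 \<tau>])
      moreover have "\<forall>\<^sub>F t in at_right 0. kernel_op \<Gamma> (\<tau> - t) (apply_bcontfun
          (u t - semigroup_S \<Gamma> t u0)) x + z = \<psi> t"
        unfolding eventually_at_right_field
      proof (intro exI[of _ \<tau>] conjI allI impI \<tau>)
        fix t assume t: "0 < t" "t < \<tau>"
        have "kernel_op \<Gamma> (\<tau> - t) (apply_bcontfun (semigroup_S \<Gamma> t u0)) x
            = kernel_op \<Gamma> (\<tau> - t + t) (apply_bcontfun u0) x"
          unfolding semigroup_S_apply[OF t(1), abs_def]
          using t kernel_op_kernel_op[OF _ t(1) apply_bcontfun_borel apply_bcontfun_abs_le, of "\<tau> - t" u0 x]
          by (simp add: semigroup_S_apply[OF t(1), abs_def])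
        then show "kernel_op \<Gamma> (\<tau> - t) (apply_bcontfun (u t - semigroup_S \<Gamma> t u0)) x + z = \<psi> t"
          using t kernel_op_diff[of "\<tau> - t" "u t" "semigroup_S \<Gamma> t u0" x] by (simp add: \<psi>_def z')
      qed
      ultimately have "(\<psi> \<longlongrightarrow> kernel_op \<Gamma> \<tau> (apply_bcontfun 0) x + z) (at_right 0)"
        by (rule Lim_transform_eventually)
      then have "(\<psi> \<longlongrightarrow> z) (at_right 0)" by (simp add: kernel_op_def)
      moreover have "at 0 within {0..<\<tau>} \<le> at_right 0"
        unfolding at_within_def by (intro inf_mono) auto
      ultimately show ?thesis using True tendsto_mono by (auto simp: \<psi>_def)
    next
      case False
      with s have s': "0 < s" "s < \<tau>" by auto
      have "isCont u s" using u(1) s' by (simp add: continuous_on_eq_continuous_at)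
      then have l1: "(u \<longlongrightarrow> u s) (at s)" by (simp add: isCont_def)
      have l2: "((\<lambda>t. \<tau> - t) \<longlongrightarrow> \<tau> - s) (at s)" by (auto intro!: tendsto_eq_intros)
      have "((\<lambda>t. kernel_op \<Gamma> (\<tau> - t) (apply_bcontfun (u t)) x) \<longlongrightarrow> \<psi> s) (at s)"
        using kernel_op_tendsto[OF l1 l2, of x] s' by (simp add: \<psi>_def)
      moreover have "\<forall>\<^sub>F t in at s. kernel_op \<Gamma> (\<tau> - t) (apply_bcontfun (u t)) x = \<psi> t"
      proof -
        have "\<forall>\<^sub>F t in at s. t \<in> {0<..}" using s' by (intro eventually_at_in_open') auto
        then show ?thesis by eventually_elim (simp add: \<psi>_def)
      qed
      ultimately have "(\<psi> \<longlongrightarrow> \<psi> s) (at s)" by (rule Lim_transform_eventually)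
      then show ?thesis by (rule tendsto_within_subset) simp
    qed
  qed
  have \<psi>_bd: "0 \<le> \<psi> s \<and> \<psi> s \<le> M" if s: "0 \<le> s" "s < \<tau>" for s
  proof (cases "s = 0")
    case True
    show ?thesis
    proof -
      have "\<bar>kernel_op \<Gamma> \<tau> (apply_bcontfun u0) x\<bar> \<le> norm u0"
        by (rule kernel_op_abs_le[OF \<tau> apply_bcontfun_abs_le])
      then show ?thesis using z True M(2) by (simp add: \<psi>_def z')
    qed
  next
    case False
    then have "\<bar>\<psi> s\<bar> \<le> M" "0 \<le> \<psi> s"
      unfolding \<psi>_def using s u(2)[of s] M(1)[of s]
      by (auto intro!: kernel_op_abs_le kernel_op_nonneg)
    then show ?thesis by simp
  qed
  \<comment> \<open>Apply \<open>S(\<tau>-s)\<close> to the integral inequality for \<open>u(s)\<close>, then Jensen's inequality under the time integral.\<close>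
  have ineq: "z + integral {0..s} (\<lambda>\<sigma>. h \<sigma> * f (\<psi> \<sigma>)) \<le> \<psi> s" if s: "0 \<le> s" "s < \<tau>" for s
  proof (cases "s = 0")
    case True
    then show ?thesis by (simp add: \<psi>_def)
  next
    case False
    with s have s': "0 < s" "0 < \<tau> - s" by auto
    let ?P = "volume_potential \<Gamma> ?\<phi> s"
    have "?P \<in> bcontfun"
    proof (rule volume_potential_bcontfun[OF C s'(1)])
      show "s \<le> \<tau>" using s by simp
      fix \<sigma> assume "0 < \<sigma>" "\<sigma> < s"
      then show "continuous_on UNIV (?\<phi> \<sigma>)"
        using u(2) by (intro continuous_on_mult continuous_on_const continuous_on_compose2[OF f(1) continuous_on_apply_bcontfun]) auto
    qed
    then obtain P where P: "?P = apply_bcontfun P" by (rule bcontfunE)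
    have S: "apply_bcontfun (semigroup_S \<Gamma> s u0) = kernel_op \<Gamma> s (apply_bcontfun u0)"
      by (rule ext) (rule semigroup_S_apply[OF s'(1)])
    have "z + kernel_op \<Gamma> (\<tau> - s) ?P x
        = kernel_op \<Gamma> (\<tau> - s) (apply_bcontfun (semigroup_S \<Gamma> s u0)) x + kernel_op \<Gamma> (\<tau> - s)
        (apply_bcontfun P) x"
      using kernel_op_kernel_op[OF s'(2,1) apply_bcontfun_borel apply_bcontfun_abs_le, of u0 x]
          by (simp add: z' P S)
    also have "\<dots> = kernel_op \<Gamma> (\<tau> - s) (apply_bcontfun (semigroup_S \<Gamma> s u0 + P)) x"
      using kernel_op_diff[OF s'(2), of "semigroup_S \<Gamma> s u0 + P" P x] by simp
    also have "\<dots> \<le> kernel_op \<Gamma> (\<tau> - s) (apply_bcontfun (u s)) x"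
    proof (rule kernel_op_mono[OF s'(2) apply_bcontfun_borel apply_bcontfun_borel])
      show "\<bar>apply_bcontfun (semigroup_S \<Gamma> s u0 + P) y\<bar>
          \<le> max (norm (semigroup_S \<Gamma> s u0 + P)) (norm (u s))" for y
        using apply_bcontfun_abs_le[of "semigroup_S \<Gamma> s u0 + P" y] by simp
      show "\<bar>apply_bcontfun (u s) y\<bar> \<le> max (norm (semigroup_S \<Gamma> s u0 + P)) (norm (u s))" for y
        using apply_bcontfun_abs_le[of "u s" y] by simp
      show "apply_bcontfun (semigroup_S \<Gamma> s u0 + P) y \<le> apply_bcontfun (u s) y" for y
        using super[OF s'(1), of y] by (simp add: P)
    qed
    also have "\<dots> = \<psi> s" using s' by (simp add: \<psi>_def)
    finally have 1: "z + kernel_op \<Gamma> (\<tau> - s) ?P x \<le> \<psi> s" .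
    have sr: "\<tau> - s + s - \<sigma> = \<tau> - \<sigma>" for \<sigma> by simp
    have 2: "kernel_op \<Gamma> (\<tau> - s) ?P x = (LINT \<sigma>:{0<..<s}|lborel. kernel_op \<Gamma> (\<tau> - \<sigma>) (?\<phi> \<sigma>) x)"
      using kernel_op_volume_potential[OF C s'(1) _ s'(2), of x] s unfolding sr by simp
    have "continuous_on {0..s} (\<lambda>\<sigma>. h \<sigma> * f (\<psi> \<sigma>))"
      by (intro continuous_on_mult continuous_on_compose2[OF f(1)] continuous_on_subset[OF h(1)] continuous_on_subset[OF \<psi>_cont])
        (use s \<psi>_bd in auto)
    then have i: "set_integrable lborel {0<..<s} (\<lambda>\<sigma>. h \<sigma> * f (\<psi> \<sigma>))"
      by (rule set_integrable_subset[OF borel_integrable_atLeastAtMost']) auto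
    have "integral {0..s} (\<lambda>\<sigma>. h \<sigma> * f (\<psi> \<sigma>)) = (LINT \<sigma>:{0<..<s}|lborel. h \<sigma> * f (\<psi> \<sigma>))"
      using set_borel_integral_eq_integral(2)[OF i] integral_open_interval_real[of 0 s] by simp
    also have "\<dots> \<le> (LINT \<sigma>:{0<..<s}|lborel. kernel_op \<Gamma> (\<tau> - \<sigma>) (?\<phi> \<sigma>) x)"
    proof (rule set_integral_mono[OF i])
      show "set_integrable lborel {0<..<s} (\<lambda>\<sigma>. kernel_op \<Gamma> (\<tau> - \<sigma>) (?\<phi> \<sigma>) x)"
        by (rule volume_potential_integrable[OF C]) (use s in auto)
      fix \<sigma> assume "\<sigma> \<in> {0<..<s}"
      with s have \<sigma>: "0 < \<sigma>" "0 < \<tau> - \<sigma>" by auto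
      have "f (semigroup_S \<Gamma> (\<tau> - \<sigma>) (u \<sigma>) x) \<le> kernel_op \<Gamma> (\<tau> - \<sigma>) (\<lambda>y. f (apply_bcontfun (u \<sigma>) y)) x"
        by (rule jensen[OF u(2)[OF \<sigma>(1)] \<sigma>(2)])
      then have "h \<sigma> * f (\<psi> \<sigma>) \<le> h \<sigma> * kernel_op \<Gamma> (\<tau> - \<sigma>) (\<lambda>y. f (apply_bcontfun (u \<sigma>) y)) x"
        using \<sigma> h(2)[of \<sigma>] by (intro mult_left_mono) (auto simp: semigroup_S_apply[OF \<sigma>(2)] \<psi>_def)
      then show "h \<sigma> * f (\<psi> \<sigma>) \<le> kernel_op \<Gamma> (\<tau> - \<sigma>) (?\<phi> \<sigma>) x"
        by (simp add: kernel_op_cmult)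
    qed
    finally show ?thesis using 1 2 by linarith
  qed
  have le: "integral {0..t} h \<le> integral {z..M} (\<lambda>s. 1 / f s)" if t: "t \<in> {0..<\<tau>}" for t
  proof (rule osgood_comparison[OF _ _ f(1) Phi(1) Phi(3)[OF order_refl] Phi(2) _ _ _ z(2)])
    show "continuous_on {0..t} h" by (rule continuous_on_subset[OF h(1)]) auto
    show "continuous_on {0..t} \<psi>" by (rule continuous_on_subset[OF \<psi>_cont]) (use t in auto)
  qed (use t h(2) \<psi>_bd ineq in auto)
  have cl: "closure {0..<\<tau>} = {0..\<tau>}" using \<tau> by simp
  show ?thesis
  proof (rule continuous_le_on_closure[where S = "{0..<\<tau>}" and f = "\<lambda>t. integral {0..t} h", OF _ _ le])
    show "continuous_on (closure {0..<\<tau>}) (\<lambda>t. integral {0..t} h)"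
      unfolding cl
      by (intro indefinite_integral_continuous_1 integrable_continuous_real continuous_on_subset[OF h(1)]) auto
    show "\<tau> \<in> closure {0..<\<tau>}" using \<tau> unfolding cl by simp
  qed
qed

text \<open>The inequality is strict, which is what excludes global solutions: a global supersolution is
bounded by some \<open>M\<close> on \<open>(0,\<tau>]\<close>, so the part of the integral of \<open>1/f\<close> beyond \<open>M\<close> is never used up.\<close>

lemma supersolution_integral_less:
  assumes h: "continuous_on {0..} h" "\<And>t. 0 \<le> t \<Longrightarrow> 0 \<le> h t"
    and f: "continuous_on {0..} f" "f \<in> Phi_class \<Gamma>"
    and u0: "\<And>x. 0 \<le> apply_bcontfun u0 x" "u0 \<noteq> 0"
    and u: "continuous_on {0<..} u" "\<And>t x. 0 < t \<Longrightarrow> 0 \<le> apply_bcontfun (u t) x"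
      "((\<lambda>t. norm (u t - semigroup_S \<Gamma> t u0)) \<longlongrightarrow> 0) (at_right 0)"
    and super: "\<And>t x. 0 < t \<Longrightarrow>
      semigroup_S \<Gamma> t u0 x + volume_potential \<Gamma> (\<lambda>\<sigma> y. h \<sigma> * f (apply_bcontfun (u \<sigma>) y)) t x
          \<le> apply_bcontfun (u t) x"
    and \<tau>: "0 < \<tau>"
  shows "(\<integral>\<^sup>+\<sigma>\<in>{0..\<tau>}. ennreal (h \<sigma>) \<partial>lborel) < (\<integral>\<^sup>+\<sigma>\<in>{norm (semigroup_S \<Gamma> \<tau> u0)..}. ennreal
      (1 / f \<sigma>) \<partial>lborel)"
proof -
  have fpos: "0 < f s" if "0 < s" for s using f(2) that unfolding Phi_class_def by blast
  define n where "n = norm (semigroup_S \<Gamma> \<tau> u0)"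
  have S_pos: "0 < semigroup_S \<Gamma> \<tau> u0 x" for x
    using kernel_op_pos[OF \<tau> u0] semigroup_S_apply[OF \<tau>] by simp
  have n: "0 < n" using S_pos[of 0] by (auto simp: n_def)
  obtain M where M: "\<And>t y. 0 < t \<Longrightarrow> t \<le> \<tau> \<Longrightarrow> \<bar>apply_bcontfun (u t) y\<bar> \<le> M"
    using bounded_on_initial_interval[OF u(1,3) semigroup_S_norm_le] by blast
  define B where "B = max M (norm u0)"
  have nB: "n \<le> B" using semigroup_S_norm_le[OF \<tau>, of u0] by (simp add: n_def B_def)
  have cf: "continuous_on {a..b} (\<lambda>s. 1 / f s)" if "0 < a" for a b
  proof (rule continuous_on_divide[OF continuous_on_const])
    show "continuous_on {a..b} f" by (rule continuous_on_subset[OF f(1)]) (use that in auto)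
    show "\<forall>s\<in>{a..b}. f s \<noteq> 0" using fpos that by (metis atLeastAtMost_iff less_irrefl order_less_le_trans)
  qed
  define P where "P w = integral {w..B} (\<lambda>s. 1 / f s)" for w
  define H where "H = integral {0..\<tau>} h"
  have bound: "H \<le> P (semigroup_S \<Gamma> \<tau> u0 x)" for x
    unfolding H_def P_def
  proof (rule supersolution_integral_bound[OF h f u0(1) u super])
    show "apply_bcontfun (u t) y \<le> B" if "0 < t" "t \<le> \<tau>" for t y
      using M[OF that, of y] by (simp add: B_def)
  qed (use \<tau> S_pos in \<open>auto simp: B_def\<close>)
  \<comment> \<open>The norm need not be attained, so \<open>H \<le> P n\<close> follows from nearby points by continuity of \<open>P\<close>.\<close>
  have HP: "H \<le> P n"
  proof (rule ccontr)
    assume "\<not> H \<le> P n"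
    have "continuous_on {n/2..B} P"
      unfolding P_def by (rule indefinite_integral_continuous_1'[OF integrable_continuous_real[OF cf]])
          (use n in simp)
    moreover have "n \<in> {n/2..B}" using n nB by simp
    moreover have "0 < H - P n" using \<open>\<not> H \<le> P n\<close> by simp
    ultimately obtain d where d: "0 < d" "\<And>w. w \<in> {n/2..B} \<Longrightarrow> dist w n < d \<Longrightarrow> dist (P w) (P n) < H - P n"
      unfolding continuous_on_iff by metis
    have "\<exists>x. max (n - d) (n / 2) < semigroup_S \<Gamma> \<tau> u0 x"
    proof (rule ccontr)
      assume "\<nexists>x. max (n - d) (n / 2) < semigroup_S \<Gamma> \<tau> u0 x"
      then have "semigroup_S \<Gamma> \<tau> u0 x \<le> max (n - d) (n / 2)" for x
        by (meson not_less)
      then have "norm (semigroup_S \<Gamma> \<tau> u0 x) \<le> max (n - d) (n / 2)" for x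
        unfolding real_norm_def abs_of_pos[OF S_pos] .
      then have "n \<le> max (n - d) (n / 2)"
        unfolding n_def by (rule norm_bound)
      then show False using n d by simp
    qed
    then obtain x where x: "max (n - d) (n / 2) < semigroup_S \<Gamma> \<tau> u0 x" by blast
    have "semigroup_S \<Gamma> \<tau> u0 x \<le> n"
      using apply_bcontfun_abs_le[of "semigroup_S \<Gamma> \<tau> u0" x] by (simp add: n_def)
    with x nB have "dist (P (semigroup_S \<Gamma> \<tau> u0 x)) (P n) < H - P n"
      by (intro d(2)) (auto simp: dist_real_def)
    then show False using bound[of x] by (auto simp: dist_real_def)
  qed
  have H0: "0 \<le> H" unfolding H_def
    by (rule Henstock_Kurzweil_Integration.integral_nonneg[OF integrable_continuous_real[OF continuous_on_subset[OF h(1)]]]) (use h(2) in auto)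
  \<comment> \<open>The part of the integral beyond \<open>B\<close> that makes the inequality strict; a unit interval suffices.\<close>
  have gap: "0 < integral {B..B+1} (\<lambda>s. 1 / f s)"
  proof -
    have B: "0 < B" using n nB by simp
    have "1 / f (B + 1) = integral {B..B+1} (\<lambda>s. 1 / f (B + 1))" by simp
    also have "\<dots> \<le> integral {B..B+1} (\<lambda>s. 1 / f s)"
    proof (rule integral_le)
      show "(\<lambda>s. 1 / f s) integrable_on {B..B+1}" by (rule integrable_continuous_real[OF cf[OF B]])
      show "1 / f (B + 1) \<le> 1 / f s" if "s \<in> {B..B+1}" for s
      proof (rule divide_left_mono)
        show "f s \<le> f (B + 1)"
          using f(2) that B by (auto simp: Phi_class_def intro: mono_onD)
      qed (use fpos[of s] fpos[of "B + 1"] that B in auto)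
    qed auto
    finally show ?thesis using fpos[of "B + 1"] B
        by (meson divide_pos_pos less_le_trans zero_less_one add_pos_pos)
  qed
  have "(\<integral>\<^sup>+\<sigma>\<in>{0..\<tau>}. ennreal (h \<sigma>) \<partial>lborel) = ennreal H"
    unfolding H_def by (rule nn_integral_Icc_continuous) (use h in \<open>auto intro: continuous_on_subset\<close>)
  also have "\<dots> < ennreal (P n + integral {B..B+1} (\<lambda>s. 1 / f s))"
    using HP H0 gap by (intro ennreal_lessI) auto
  also have "P n + integral {B..B+1} (\<lambda>s. 1 / f s) = integral {n..B+1} (\<lambda>s. 1 / f s)"
    unfolding P_def by (rule Henstock_Kurzweil_Integration.integral_combine)
      (use nB in \<open>auto intro!: integrable_continuous_real cf n\<close>)
  also have "ennreal \<dots> = (\<integral>\<^sup>+\<sigma>\<in>{n..B+1}. ennreal (1 / f \<sigma>) \<partial>lborel)"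
    by (rule nn_integral_Icc_continuous[symmetric, OF cf[OF n]])
        (use fpos n in \<open>auto intro!: less_imp_le[OF fpos]\<close>)
  also have "\<dots> \<le> (\<integral>\<^sup>+\<sigma>\<in>{n..}. ennreal (1 / f \<sigma>) \<partial>lborel)"
    by (intro nn_integral_mono mult_left_mono) (auto simp: indicator_def)
  finally show ?thesis by (simp add: n_def)
qed

end

section \<open>Global existence and non-existence\<close>

theorem theorem1p2:
  fixes \<omega> :: "real ^ 'n::finite \<Rightarrow> real" and i :: 'n and \<alpha> :: real
    and \<Gamma> :: "real ^ 'n \<Rightarrow> real ^ 'n \<Rightarrow> real \<Rightarrow> real"
    and h l f g :: "real \<Rightarrow> real"
  assumes weight: "degenerate_weight i \<alpha> \<omega>"
    and Gamma: "fundamental_solution \<omega> \<Gamma>" "kernel_properties \<omega> \<alpha> \<Gamma>"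
    and h: "continuous_on {0..} h" "\<forall>t\<ge>0. 0 \<le> h t"
    and l: "continuous_on {0..} l" "\<forall>t\<ge>0. 0 \<le> l t"
    and f: "local_lipschitz (UNIV :: real set) {0..} (\<lambda>_. f)" "\<forall>s\<ge>0. 0 \<le> f s" "f 0 = 0"
    and g: "local_lipschitz (UNIV :: real set) {0..} (\<lambda>_. g)" "\<forall>s\<ge>0. 0 \<le> g s" "g 0 = 0"
  shows
    "(\<forall>m (v0 :: (real ^ 'n) \<Rightarrow>\<^sub>C real).
        0 < m \<and>
        mono_on {0<..m} f \<and> mono_on {0<..m} g \<and>
        mono_on {0<..m} (\<lambda>s. f s / s) \<and> mono_on {0<..m} (\<lambda>s. g s / s) \<and>
        v0 \<noteq> 0 \<and> (\<forall>x. 0 \<le> apply_bcontfun v0 x) \<and> norm v0 \<le> m \<and>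
        (\<integral>\<^sup>+\<sigma>\<in>{0..}. ennreal (h \<sigma> * (f (norm (semigroup_S \<Gamma> \<sigma> v0)) / norm (semigroup_S \<Gamma> \<sigma> v0))) \<partial>lborel)
        + (\<integral>\<^sup>+\<sigma>\<in>{0..}. ennreal (l \<sigma> * (g (norm (semigroup_S \<Gamma> \<sigma> v0)) / norm (semigroup_S \<Gamma> \<sigma> v0))) \<partial>lborel)
          < 1
        \<longrightarrow> (\<exists>\<delta>>0. \<exists>u. is_global_solution \<Gamma> h l f g (\<delta> *\<^sub>R v0) u)) \<and>
     (\<forall>u0 :: (real ^ 'n) \<Rightarrow>\<^sub>C real.
        (\<forall>x. 0 \<le> apply_bcontfun u0 x) \<and> u0 \<noteq> 0 \<and>
        ((f \<in> Phi_class \<Gamma> \<and>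
          (\<exists>\<tau>>0. (\<integral>\<^sup>+\<sigma>\<in>{norm (semigroup_S \<Gamma> \<tau> u0)..}. ennreal (1 / f \<sigma>) \<partial>lborel)
                    \<le> (\<integral>\<^sup>+\<sigma>\<in>{0..\<tau>}. ennreal (h \<sigma>) \<partial>lborel))) \<or>
         (g \<in> Phi_class \<Gamma> \<and>
          (\<exists>\<tau>>0. (\<integral>\<^sup>+\<sigma>\<in>{norm (semigroup_S \<Gamma> \<tau> u0)..}. ennreal (1 / g \<sigma>) \<partial>lborel)
                    \<le> (\<integral>\<^sup>+\<sigma>\<in>{0..\<tau>}. ennreal (l \<sigma>) \<partial>lborel))))
        \<longrightarrow> \<not> (\<exists>u. is_global_solution \<Gamma> h l f g u0 u))"
proof -
  interpret markov_kernel \<Gamma> by (rule kernel_properties_imp_markov_kernel[OF Gamma(2)])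
  have cf: "continuous_on {0..} f" and cg: "continuous_on {0..} g"
    using local_lipschitz_continuous_on[OF f(1)] local_lipschitz_continuous_on[OF g(1)] by auto
  have blow_up: False
    if sol: "is_global_solution \<Gamma> h l f g u0 u" and u0: "\<forall>x. 0 \<le> apply_bcontfun u0 x" "u0 \<noteq> 0"
      and p: "continuous_on {0..} p" "\<forall>t\<ge>0. 0 \<le> p t" and q: "continuous_on {0..} q" "q \<in> Phi_class \<Gamma>"
      and pq: "p = h \<and> q = f \<or> p = l \<and> q = g" and \<tau>: "0 < \<tau>"
      and le: "(\<integral>\<^sup>+\<sigma>\<in>{norm (semigroup_S \<Gamma> \<tau> u0)..}. ennreal (1 / q \<sigma>) \<partial>lborel)
          \<le> (\<integral>\<^sup>+\<sigma>\<in>{0..\<tau>}. ennreal (p \<sigma>) \<partial>lborel)"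
    for u0 u p q \<tau>
  proof -
    have u: "continuous_on {0<..} u" "\<And>t x. 0 < t \<Longrightarrow> 0 \<le> apply_bcontfun (u t) x"
      using sol by (auto simp: is_global_solution_def is_solution_def greaterThan_def)
    have lim: "((\<lambda>t. norm (u t - semigroup_S \<Gamma> t u0)) \<longlongrightarrow> 0) (at_right 0)"
      and eq: "\<And>t x. 0 < t \<Longrightarrow> u t x = semigroup_S \<Gamma> t u0 x + duhamel \<Gamma> h f u t x + duhamel \<Gamma> l g u t x"
      using sol by (auto simp: is_global_solution_def is_solution_def integral_equation_def greaterThan_def)
    have "semigroup_S \<Gamma> t u0 x + volume_potential \<Gamma> (\<lambda>\<sigma> y. p \<sigma> * q (apply_bcontfun (u \<sigma>) y)) t x
        \<le> apply_bcontfun (u t) x"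
      if t: "0 < t" for t x
    proof -
      have "0 \<le> duhamel \<Gamma> h f u t x" "0 \<le> duhamel \<Gamma> l g u t x"
        unfolding duhamel_eq_volume_potential
        by (rule volume_potential_nonneg; use h(2) l(2) f(2) g(2) u(2) in simp)+
      then show ?thesis using eq[OF t, of x] pq by (auto simp: duhamel_eq_volume_potential)
    qed
    from supersolution_integral_less[OF p(1) _ q _ u0(2) u lim this \<tau>] p(2) u0(1) le show False by auto
  qed
  show ?thesis
  proof (intro conjI allI impI notI)
    fix m and v0 :: "(real ^ 'n) \<Rightarrow>\<^sub>C real"
    assume A: "0 < m \<and> mono_on {0<..m} f \<and> mono_on {0<..m} g \<and>
        mono_on {0<..m} (\<lambda>s. f s / s) \<and> mono_on {0<..m} (\<lambda>s. g s / s) \<and>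
        v0 \<noteq> 0 \<and> (\<forall>x. 0 \<le> apply_bcontfun v0 x) \<and> norm v0 \<le> m \<and>
        (\<integral>\<^sup>+\<sigma>\<in>{0..}. ennreal (h \<sigma> * (f (norm (semigroup_S \<Gamma> \<sigma> v0)) / norm (semigroup_S \<Gamma> \<sigma> v0))) \<partial>lborel)
        + (\<integral>\<^sup>+\<sigma>\<in>{0..}. ennreal (l \<sigma> * (g (norm (semigroup_S \<Gamma> \<sigma> v0)) / norm
            (semigroup_S \<Gamma> \<sigma> v0))) \<partial>lborel) < 1"
    show "\<exists>\<delta>>0. \<exists>u. is_global_solution \<Gamma> h l f g (\<delta> *\<^sub>R v0) u"
      by (rule small_data_global_solution[where m = m]) (use A h l f g in auto)
  next
    fix u0 :: "(real ^ 'n) \<Rightarrow>\<^sub>C real"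
    assume A: "(\<forall>x. 0 \<le> apply_bcontfun u0 x) \<and> u0 \<noteq> 0 \<and>
        ((f \<in> Phi_class \<Gamma> \<and>
          (\<exists>\<tau>>0. (\<integral>\<^sup>+\<sigma>\<in>{norm (semigroup_S \<Gamma> \<tau> u0)..}. ennreal (1 / f \<sigma>) \<partial>lborel)
                    \<le> (\<integral>\<^sup>+\<sigma>\<in>{0..\<tau>}. ennreal (h \<sigma>) \<partial>lborel))) \<or>
         (g \<in> Phi_class \<Gamma> \<and>
          (\<exists>\<tau>>0. (\<integral>\<^sup>+\<sigma>\<in>{norm (semigroup_S \<Gamma> \<tau> u0)..}. ennreal (1 / g \<sigma>) \<partial>lborel)
                    \<le> (\<integral>\<^sup>+\<sigma>\<in>{0..\<tau>}. ennreal (l \<sigma>) \<partial>lborel))))"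
    assume "\<exists>u. is_global_solution \<Gamma> h l f g u0 u"
    then obtain u where u: "is_global_solution \<Gamma> h l f g u0 u" by blast
    from A have u0: "\<forall>x. 0 \<le> apply_bcontfun u0 x" "u0 \<noteq> 0" by auto
    from A consider \<tau> where "f \<in> Phi_class \<Gamma>" "0 < \<tau>"
        "(\<integral>\<^sup>+\<sigma>\<in>{norm (semigroup_S \<Gamma> \<tau> u0)..}. ennreal (1 / f \<sigma>) \<partial>lborel)
            \<le> (\<integral>\<^sup>+\<sigma>\<in>{0..\<tau>}. ennreal (h \<sigma>) \<partial>lborel)"
      | \<tau> where "g \<in> Phi_class \<Gamma>" "0 < \<tau>"
        "(\<integral>\<^sup>+\<sigma>\<in>{norm (semigroup_S \<Gamma> \<tau> u0)..}. ennreal (1 / g \<sigma>) \<partial>lborel)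
            \<le> (\<integral>\<^sup>+\<sigma>\<in>{0..\<tau>}. ennreal (l \<sigma>) \<partial>lborel)"
      by blast
    then show False
    proof cases
      case 1
      show False by (rule blow_up[OF u u0 h cf 1(1) _ 1(2,3)]) simp
    next
      case 2
      show False by (rule blow_up[OF u u0 l cg 2(1) _ 2(2,3)]) simp
    qed
  qed
qed

end
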